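(* Let $({\rm X},{\sf d},\mathfrak m)$ be a metric measure space, $q\in(1,\infty]$ with conjugate exponent $p$, $b\in{\rm Der}^q_{\mathfrak M}({\rm X})$, and $E\subseteq{\rm X}$ a Borel set. Then: if ${\bf div}(b)^-(E)>0$, then ${\rm Mod}_p(\{\gamma\in C([0,1];{\rm X}):\gamma_0\in E,\ \ell(\gamma)>0\})>0$; and if ${\bf div}(b)^+(E)>0$, then ${\rm Mod}_p(\{\gamma\in C([0,1];{\rm X}):\gamma_1\in E,\ \ell(\gamma)>0\})>0$. In particular, if $E$ is $p$-exceptional, then $|{\bf div}(b)|(E)=0$.
   Context: A metric measure space is a complete separable metric space $({\rm X},{\sf d})$ with a nonnegative Borel measure $\mathfrak m$ finite on bounded Borel sets. ${\rm LIP}_{bs}({\rm X})$: bounded Lipschitz functions with bounded support; ${\rm lip}_a(f)(x)=\limsup_{y,z\to x,y\ne z}|f(y)-f(z)|/{\sf d}(y,z)$ ($0$ at isolated points). A Lipschitz $q$-derivation is a linear $b\colon{\rm LIP}_{bs}({\rm X})\to L^q(\mathfrak m)$ with $b(fg)=fb(g)+gb(f)$ and $|b(f)|\le g\,{\rm lip}_a(f)$ for some $g\in L^q(\mathfrak m)^+$. ${\rm Der}^q_{\mathfrak M}({\rm X})$ is the set of such $b$ for which there is a boundedly-finite signed Borel measure ${\bf div}(b)$ (a map on bounded Borel sets whose restriction to any bounded Borel set is a finite signed measure) with $\int b(f)d\mathfrak m=-\int f\,d{\bf div}(b)$ for all $f\in{\rm LIP}_{bs}({\rm X})$; ${\bf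 div}(b)^\pm$ and $|{\bf div}(b)|$ are its positive/negative parts and total variation. $\ell(\gamma)$ is the length of a curve; for a family $\Gamma$ of curves, ${\rm Mod}_p(\Gamma)=\inf\{\int\rho^pd\mathfrak m:\rho\ge0\text{ Borel},\ \int_\gamma\rho\,ds\ge1\ \forall\gamma\in\Gamma\}$, where $\int_\gamma\rho\,ds=\ell(\gamma)\int_0^1\rho(\gamma^{cs}_t)dt$ for rectifiable $\gamma$ (with $\gamma^{cs}$ the constant-speed reparametrisation) and $+\infty$ otherwise. A set $E$ is $p$-exceptional if the family of nonconstant curves meeting $E$ has zero $p$-modulus. *)

theory Defs
  imports "HOL-Analysis.Analysis"
begin

definition mm_space :: "'a::{polish_space,metric_space} measure \<Rightarrow> bool" where
  "mm_space m \<longleftrightarrow> sets m = sets borel \<and>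
     (\<forall>B\<in>sets borel. bounded B \<longrightarrow> emeasure m B < \<infinity>)"

definition conjugate_exps :: "real \<Rightarrow> ereal \<Rightarrow> bool" where
  "conjugate_exps p q \<longleftrightarrow> 1 < q \<and>
     (if q = \<infinity> then p = 1 else p = real_of_ereal q / (real_of_ereal q - 1))"

definition Lq :: "'a measure \<Rightarrow> ereal \<Rightarrow> ('a \<Rightarrow> real) \<Rightarrow> bool" where
  "Lq m q f \<longleftrightarrow> f \<in> borel_measurable m \<and>
     (if q = \<infinity> then (\<exists>C. AE x in m. \<bar>f x\<bar> \<le> C)
      else integrable m (\<lambda>x. \<bar>f x\<bar> powr real_of_ereal q))"

definition LIP_bs :: "('a::metric_space \<Rightarrow> real) set" where
  "LIP_bs = {f. (\<exists>L. L-lipschitz_on UNIV f) \<and> bounded (range f) \<and> bounded {x. f x \<noteq> 0}}"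

definition lip_a :: "('a::metric_space \<Rightarrow> real) \<Rightarrow> 'a \<Rightarrow> real" where
  "lip_a f x = (if x islimpt (UNIV :: 'a set) then
      Inf ((\<lambda>r. Sup {\<bar>f y - f z\<bar> / dist y z | y z. y \<in> ball x r \<and> z \<in> ball x r \<and> y \<noteq> z})
            ` {0<..})
    else 0)"

definition lip_derivation :: "'a::metric_space measure \<Rightarrow> ereal \<Rightarrow> (('a \<Rightarrow> real) \<Rightarrow> 'a \<Rightarrow> real) \<Rightarrow> bool" where
  "lip_derivation m q b \<longleftrightarrow>
     (\<forall>f\<in>LIP_bs. Lq m q (b f)) \<and>
     (\<forall>f\<in>LIP_bs. \<forall>g\<in>LIP_bs. \<forall>\<alpha> \<beta>::real.
        AE x in m. b (\<lambda>y. \<alpha> * f y + \<beta> * g y) x = \<alpha> * b f x + \<beta> * b g x) \<and>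
     (\<forall>f\<in>LIP_bs. \<forall>g\<in>LIP_bs.
        AE x in m. b (\<lambda>y. f y * g y) x = f x * b g x + g x * b f x) \<and>
     (\<exists>G. Lq m q G \<and> (\<forall>x. 0 \<le> G x) \<and>
        (\<forall>f\<in>LIP_bs. AE x in m. \<bar>b f x\<bar> \<le> G x * lip_a f x))"

text \<open>A boundedly-finite signed Borel measure is represented through its Jordan decomposition:
  two Borel measures mu_plus, mu_minus, finite on bounded Borel sets and mutually singular;
  the signed measure is mu_plus - mu_minus (on bounded Borel sets), its positive and negative
  parts are mu_plus and mu_minus, and its total variation is mu_plus + mu_minus.\<close>

definition bf_jordan_pair :: "'a::metric_space measure \<Rightarrow> 'a measure \<Rightarrow> bool" where
  "bf_jordan_pair \<mu>P \<mu>N \<longleftrightarrow>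
     sets \<mu>P = sets borel \<and> sets \<mu>N = sets borel \<and>
     (\<forall>B\<in>sets borel. bounded B \<longrightarrow> emeasure \<mu>P B < \<infinity> \<and> emeasure \<mu>N B < \<infinity>) \<and>
     (\<exists>S\<in>sets borel. emeasure \<mu>P (UNIV - S) = 0 \<and> emeasure \<mu>N S = 0)"

definition is_divergence ::
  "'a::metric_space measure \<Rightarrow> (('a \<Rightarrow> real) \<Rightarrow> 'a \<Rightarrow> real) \<Rightarrow> 'a measure \<Rightarrow> 'a measure \<Rightarrow> bool" where
  "is_divergence m b \<mu>P \<mu>N \<longleftrightarrow> bf_jordan_pair \<mu>P \<mu>N \<and>
     (\<forall>f\<in>LIP_bs. (\<integral>x. b f x \<partial>m) = - ((\<integral>x. f x \<partial>\<mu>P) - (\<integral>x. f x \<partial>\<mu>N)))"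

definition curve_length_on :: "(real \<Rightarrow> 'a::metric_space) \<Rightarrow> real \<Rightarrow> real \<Rightarrow> ennreal" where
  "curve_length_on \<gamma> a b = (SUP (n, t) \<in> {(n, t). t 0 = a \<and> t n = b \<and> (\<forall>i<n. t i \<le> t (Suc i))}.
      (\<Sum>i<n. ennreal (dist (\<gamma> (t i)) (\<gamma> (t (Suc i))))))"

definition curve_length :: "(real \<Rightarrow> 'a::metric_space) \<Rightarrow> ennreal" where
  "curve_length \<gamma> = curve_length_on \<gamma> 0 1"

definition const_speed :: "(real \<Rightarrow> 'a::metric_space) \<Rightarrow> real \<Rightarrow> 'a" where
  "const_speed \<gamma> s = \<gamma> (SOME t. t \<in> {0..1} \<and> curve_length_on \<gamma> 0 t = ennreal s * curve_length \<gamma>)"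

definition line_integral :: "(real \<Rightarrow> 'a::metric_space) \<Rightarrow> ('a \<Rightarrow> ennreal) \<Rightarrow> ennreal" where
  "line_integral \<gamma> \<rho> = (if curve_length \<gamma> < \<infinity>
      then curve_length \<gamma> * (\<integral>\<^sup>+ t\<in>{0..1}. \<rho> (const_speed \<gamma> t) \<partial>lborel)
      else \<infinity>)"

definition enn_powr :: "ennreal \<Rightarrow> real \<Rightarrow> ennreal" where
  "enn_powr x p = (if x = \<infinity> then \<infinity> else ennreal (enn2real x powr p))"

definition curve_modulus :: "'a::metric_space measure \<Rightarrow> real \<Rightarrow> (real \<Rightarrow> 'a) set \<Rightarrow> ennreal" where
  "curve_modulus m p \<Gamma> = (INF \<rho> \<in> {\<rho>. \<rho> \<in> borel_measurable borel \<and> (\<forall>\<gamma>\<in>\<Gamma>. 1 \<le> line_integral \<gamma> \<rho>)}.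
      \<integral>\<^sup>+ x. enn_powr (\<rho> x) p \<partial>m)"

definition curves :: "(real \<Rightarrow> 'a::topological_space) set" where
  "curves = {\<gamma>. continuous_on {0..1} \<gamma>}"

definition p_exceptional :: "'a::metric_space measure \<Rightarrow> real \<Rightarrow> 'a set \<Rightarrow> bool" where
  "p_exceptional m p E \<longleftrightarrow>
     curve_modulus m p {\<gamma>\<in>curves. curve_length \<gamma> > 0 \<and> (\<exists>t\<in>{0..1}. \<gamma> t \<in> E)} = 0"

end

(*
Suppose that the curves issuing from E have zero modulus but the negative part of the divergence
charges E. It then charges a compact K in E that is null for the positive part. Choose a bounded
open U around K of small positive part, and a weight rho of small L^p norm that is admissible for
the curves, enlarged to a supremum of continuous weights g_n. The potential u_n(x), the infimum of
1 and of the g_n-costs of chains of short steps leading from x out of U, is Lipschitz, vanishes off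
U and satisfies lip_a(u_n) <= g_n. Testing the divergence with u_n bounds its integral against the
negative part by a small quantity (Hoelder) plus the positive part of U. On the other hand
u_n >= 1/2 on K for some n: otherwise chains of cost < 1/2 would converge, by an Arzela-Ascoli
argument, to a curve from K out of U with rho-integral at most 1/2. For curves ending in E the
limit curve is run backwards and b is replaced by -b.
*)

theory Submission
  imports Defs "HOL-Library.Diagonal_Subsequence"
begin

section \<open>Length and line integrals of Lipschitz curves\<close>

text \<open>An infimum over genuine curves need not be continuous, and a general space may contain
  few curves. Chains of jumps avoid this: prepending one step to a chain already yields the
  Lipschitz bound and the slope of the potential. The price is that cheap chains must be turned into
  a curve without local compactness. Two features of the weights serve this: a positive floor, which
  bounds the exit times, and summands that grow off compact sets, which confine cheap chains near
  those sets. The weights must be continuous because \<open>lip_a\<close> compares all pairs of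
  points near \<open>x\<close>, and must increase to a majorant of \<rho> so that the bound for each
  fixed weight passes to the limit by Fatou's lemma. They are built with respect to \<open>m\<close>
  restricted to the closure of U: regularity of measures is applied to finite measures, and the
  slope of the potential vanishes off that closure. The threshold 1/2 only has to lie strictly
  between 0 and the admissibility level 1.\<close>

lemma curve_length_on_upper:
  assumes "t 0 = a" "t n = b" "\<And>i. i < n \<Longrightarrow> t i \<le> t (Suc i)"
  shows "(\<Sum>i<n. ennreal (dist (\<gamma> (t i)) (\<gamma> (t (Suc i))))) \<le> curve_length_on \<gamma> a b"
  unfolding curve_length_on_def
  by (rule SUP_upper2[of "(n, t)"]) (use assms in auto)

lemma curve_length_on_least:
  assumes "\<And>n t. \<lbrakk>t 0 = a; t n = b; \<And>i. i < n \<Longrightarrow> t i \<le> t (Suc i)\<rbrakk> \<Longrightarrow>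
      (\<Sum>i<n. ennreal (dist (\<gamma> (t i)) (\<gamma> (t (Suc i))))) \<le> c"
  shows "curve_length_on \<gamma> a b \<le> c"
  unfolding curve_length_on_def
  by (rule SUP_least) (use assms in auto)

lemma curve_length_on_add_dist:
  fixes s t :: real
  assumes "a \<le> s" "s \<le> t"
  shows "curve_length_on \<gamma> a s + ennreal (dist (\<gamma> s) (\<gamma> t)) \<le> curve_length_on \<gamma> a t"
proof -
  define I where "I = {(n, \<tau>). \<tau> 0 = a \<and> \<tau> n = s \<and> (\<forall>i<n. (\<tau> i :: real) \<le> \<tau> (Suc i))}"
  have "(1, \<lambda>i. if i = 0 then a else s) \<in> I"
    using assms by (auto simp: I_def)
  hence "I \<noteq> {}"
    by blast
  hence "curve_length_on \<gamma> a s + ennreal (dist (\<gamma> s) (\<gamma> t))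
      = (SUP (n, \<tau>) \<in> I. (\<Sum>i<n. ennreal (dist (\<gamma> (\<tau> i)) (\<gamma> (\<tau> (Suc i))))) + ennreal (dist (\<gamma> s) (\<gamma> t)))"
    unfolding curve_length_on_def I_def[symmetric]
    by (subst ennreal_SUP_add_left[symmetric]) (auto simp: case_prod_beta)
  also have "\<dots> \<le> curve_length_on \<gamma> a t"
  proof (rule SUP_least, clarify)
    fix n \<tau> assume "(n, \<tau>) \<in> I"
    hence I: "\<tau> 0 = a" "\<tau> n = s" "\<And>i. i < n \<Longrightarrow> \<tau> i \<le> \<tau> (Suc i)"
      by (auto simp: I_def)
    define \<sigma> where "\<sigma> = \<tau>(Suc n := t)"
    have "(\<Sum>i<n. ennreal (dist (\<gamma> (\<tau> i)) (\<gamma> (\<tau> (Suc i))))) + ennreal (dist (\<gamma> s) (\<gamma> t))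
        = (\<Sum>i<Suc n. ennreal (dist (\<gamma> (\<sigma> i)) (\<gamma> (\<sigma> (Suc i)))))"
      using I by (simp add: \<sigma>_def)
    also have "\<dots> \<le> curve_length_on \<gamma> a t"
      by (rule curve_length_on_upper) (use I assms in \<open>auto simp: \<sigma>_def less_Suc_eq\<close>)
    finally show "(\<Sum>i<n. ennreal (dist (\<gamma> (\<tau> i)) (\<gamma> (\<tau> (Suc i))))) + ennreal (dist (\<gamma> s) (\<gamma> t))
        \<le> curve_length_on \<gamma> a t" .
  qed
  finally show ?thesis .
qed

lemma partition_mono:
  fixes \<tau> :: "nat \<Rightarrow> real"
  assumes "\<And>i. i < n \<Longrightarrow> \<tau> i \<le> \<tau> (Suc i)" "i \<le> n"
  shows "\<tau> 0 \<le> \<tau> i" "\<tau> i \<le> \<tau> n"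
proof -
  show "\<tau> 0 \<le> \<tau> i"
    using assms by (induction i) (auto intro: order_trans)
  show "\<tau> i \<le> \<tau> n"
    using \<open>i \<le> n\<close> by (induction rule: inc_induct) (auto intro: order_trans assms(1))
qed

lemma curve_length_on_lipschitz:
  assumes "L-lipschitz_on {a..t} \<gamma>"
  shows "curve_length_on \<gamma> a t \<le> ennreal (L * (t - a))"
proof (rule curve_length_on_least)
  fix n \<tau>
  assume \<tau>: "\<tau> 0 = a" "\<tau> n = t" "\<And>i. i < n \<Longrightarrow> \<tau> i \<le> \<tau> (Suc i)"
  have "(\<Sum>i<n. dist (\<gamma> (\<tau> i)) (\<gamma> (\<tau> (Suc i)))) \<le> (\<Sum>i<n. L * (\<tau> (Suc i) - \<tau> i))"
  proof (rule sum_mono)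
    fix i assume "i \<in> {..<n}"
    hence "\<tau> i \<in> {a..t}" "\<tau> (Suc i) \<in> {a..t}" "\<tau> i \<le> \<tau> (Suc i)"
      using partition_mono[of n \<tau> i] partition_mono[of n \<tau> "Suc i"] \<tau> by auto
    thus "dist (\<gamma> (\<tau> i)) (\<gamma> (\<tau> (Suc i))) \<le> L * (\<tau> (Suc i) - \<tau> i)"
      using lipschitz_onD[OF assms, of "\<tau> i" "\<tau> (Suc i)"] by (auto simp: dist_real_def)
  qed
  also have "\<dots> = L * (t - a)"
    using \<tau> by (simp add: sum_distrib_left[symmetric] sum_lessThan_telescope)
  finally show "(\<Sum>i<n. ennreal (dist (\<gamma> (\<tau> i)) (\<gamma> (\<tau> (Suc i))))) \<le> ennreal (L * (t - a))"
    by (simp add: sum_ennreal ennreal_leI)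
qed

text \<open>Induction over the partition: a last cell beyond \<open>s\<close> costs at most
  \<open>L\<close> times its length, and a last cell straddling \<open>s\<close> is split there.
  With \<open>curve_length_on_add_dist\<close> this makes arc length nondecreasing and Lipschitz
  without proving additivity of length.\<close>

lemma curve_length_on_le_add_lipschitz:
  assumes lip: "L-lipschitz_on {a..t} \<gamma>" and "a \<le> s" "s \<le> t"
  shows "curve_length_on \<gamma> a t \<le> curve_length_on \<gamma> a s + ennreal (L * (t - s))"
proof (rule curve_length_on_least)
  have L0: "0 \<le> L"
    using lip by (rule lipschitz_on_nonneg)
  fix n \<tau>
  assume "\<tau> 0 = a" "\<tau> n = t" "\<And>i. i < n \<Longrightarrow> \<tau> i \<le> \<tau> (Suc i)"
  with assms show "(\<Sum>i<n. ennreal (dist (\<gamma> (\<tau> i)) (\<gamma> (\<tau> (Suc i)))))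
      \<le> curve_length_on \<gamma> a s + ennreal (L * (t - s))"
  proof (induction n arbitrary: t)
    case 0
    thus ?case by simp
  next
    case (Suc n)
    let ?S = "\<Sum>i<n. ennreal (dist (\<gamma> (\<tau> i)) (\<gamma> (\<tau> (Suc i))))"
    have an: "a \<le> \<tau> n" and nt: "\<tau> n \<le> t"
      using partition_mono[of "Suc n" \<tau> n] Suc.prems by auto
    show ?case
    proof (cases "s \<le> \<tau> n")
      case True
      have "?S \<le> curve_length_on \<gamma> a s + ennreal (L * (\<tau> n - s))"
      proof (rule Suc.IH)
        show "L-lipschitz_on {a..\<tau> n} \<gamma>"
          by (rule lipschitz_on_subset[OF Suc.prems(1)]) (use nt in auto)
      qed (use Suc.prems True in auto)
      moreover have "dist (\<gamma> (\<tau> n)) (\<gamma> t) \<le> L * (t - \<tau> n)"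
        using lipschitz_onD[OF Suc.prems(1), of "\<tau> n" t] an nt by (auto simp: dist_real_def)
      ultimately have "?S + ennreal (dist (\<gamma> (\<tau> n)) (\<gamma> t)) \<le>
          (curve_length_on \<gamma> a s + ennreal (L * (\<tau> n - s))) + ennreal (L * (t - \<tau> n))"
        by (intro add_mono ennreal_leI)
      also have "\<dots> = curve_length_on \<gamma> a s + ennreal (L * (t - s))"
        using True nt L0 by (simp add: add.assoc ennreal_plus[symmetric] distrib_left[symmetric] del: ennreal_plus)
      finally show ?thesis
        using Suc.prems by simp
    next
      case False
      have "dist (\<gamma> (\<tau> n)) (\<gamma> t) \<le> dist (\<gamma> (\<tau> n)) (\<gamma> s) + dist (\<gamma> s) (\<gamma> t)"
        by (rule dist_triangle)
      also have "dist (\<gamma> s) (\<gamma> t) \<le> L * (t - s)"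
        using lipschitz_onD[OF Suc.prems(1), of s t] Suc.prems by (auto simp: dist_real_def)
      finally have "ennreal (dist (\<gamma> (\<tau> n)) (\<gamma> t)) \<le> ennreal (dist (\<gamma> (\<tau> n)) (\<gamma> s)) + ennreal (L * (t - s))"
        using L0 Suc.prems by (simp add: ennreal_plus[symmetric] ennreal_leI del: ennreal_plus)
      moreover have "?S \<le> curve_length_on \<gamma> a (\<tau> n)"
        by (rule curve_length_on_upper) (use Suc.prems in auto)
      ultimately have "?S + ennreal (dist (\<gamma> (\<tau> n)) (\<gamma> t)) \<le>
          curve_length_on \<gamma> a (\<tau> n) + ennreal (dist (\<gamma> (\<tau> n)) (\<gamma> s)) + ennreal (L * (t - s))"
        by (simp add: add.assoc add_mono)
      also have "\<dots> \<le> curve_length_on \<gamma> a s + ennreal (L * (t - s))"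
        using False an by (intro add_right_mono curve_length_on_add_dist) auto
      finally show ?thesis
        using Suc.prems by simp
    qed
  qed
qed

lemma dist_le_curve_length: "ennreal (dist (\<gamma> 0) (\<gamma> 1)) \<le> curve_length \<gamma>"
  using curve_length_on_add_dist[of 0 0 1 \<gamma>] unfolding curve_length_def
  by (rule order_trans[rotated]) (auto intro: add_increasing)

text \<open>The map \<open>\<phi>\<close> stretches lengths by at most \<open>M\<close>. As \<open>f\<close> oscillates by at most \<open>e'\<close> on the
  image of each interval of a fine partition, comparing the integrals there costs only \<open>M * e'\<close>.\<close>

lemma integral_le_mono_lipschitz:
  fixes f \<phi> :: "real \<Rightarrow> real"
  assumes f: "continuous_on {0..1} f" "\<And>x. x \<in> {0..1} \<Longrightarrow> 0 \<le> f x"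
    and \<phi>: "M-lipschitz_on {0..1} \<phi>" "mono_on {0..1} \<phi>" "\<phi> 0 = 0" "\<phi> 1 = 1"
  shows "integral {0..1} f \<le> M * integral {0..1} (\<lambda>t. f (\<phi> t))"
proof (rule field_le_epsilon)
  fix e :: real assume e: "0 < e"
  have M0: "0 \<le> M"
    using \<phi>(1) by (rule lipschitz_on_nonneg)
  define e' where "e' = e / (M + 1)"
  have e': "0 < e'" "M * e' \<le> e"
    using e M0 by (auto simp: e'_def field_simps)
  have \<phi>01: "\<phi> t \<in> {0..1}" if "t \<in> {0..1}" for t
    using mono_onD[OF \<phi>(2), of 0 t] mono_onD[OF \<phi>(2), of t 1] that \<phi>(3,4) by auto
  have cf: "continuous_on {0..1} (\<lambda>t. f (\<phi> t))"
    by (rule continuous_on_compose2[OF f(1) lipschitz_on_continuous_on[OF \<phi>(1)]]) (use \<phi>01 in auto)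
  have int_f: "f integrable_on {u..v}" if "0 \<le> u" "v \<le> 1" for u v
    by (rule integrable_continuous_real, rule continuous_on_subset[OF f(1)]) (use that in auto)
  have int_h: "(\<lambda>t. f (\<phi> t)) integrable_on {u..v}" if "0 \<le> u" "v \<le> 1" for u v
    by (rule integrable_continuous_real, rule continuous_on_subset[OF cf]) (use that in auto)
  have "uniformly_continuous_on {0..1} f"
    by (rule compact_uniformly_continuous[OF f(1)]) auto
  then obtain d where d: "0 < d" "\<And>x y. \<lbrakk>x \<in> {0..1}; y \<in> {0..1}; dist y x < d\<rbrakk> \<Longrightarrow> dist (f y) (f x) < e'"
    unfolding uniformly_continuous_on_def using e'(1) by metis
  obtain N :: nat where N: "N > 0" "M / N < d"
  proof -
    obtain N :: nat where "M / d < N"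
      using reals_Archimedean2 by blast
    moreover from this have "real N > 0"
      using M0 d by (smt (verit) divide_nonneg_pos)
    ultimately show ?thesis
      using that[of N] d by (simp add: field_simps)
  qed
  \<comment> \<open>Excess of the right-hand side up to time \<open>t\<close>, error term included.
    It vanishes at 0 and its sign at 1 is the claim, so monotonicity along a grid of mesh
    \<open>1 / N\<close> suffices.\<close>
  define D where "D t = M * integral {0..t} (\<lambda>t. f (\<phi> t)) + M * e' * t - integral {0..\<phi> t} f" for t
  have step: "D s \<le> D t" if st: "0 \<le> s" "s \<le> t" "t \<le> 1" "t - s \<le> 1 / N" for s t
  proof -
    have \<phi>st: "\<phi> s \<le> \<phi> t" "0 \<le> \<phi> s" "\<phi> t \<le> 1" "\<phi> t - \<phi> s \<le> M * (t - s)"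
      using mono_onD[OF \<phi>(2), of s t] \<phi>01[of s] \<phi>01[of t] lipschitz_onD[OF \<phi>(1), of s t] st
      by (auto simp: dist_real_def)
    have "M * (t - s) \<le> M * (1 / N)"
      by (rule mult_left_mono[OF st(4) M0])
    hence small: "\<phi> t - \<phi> s < d"
      using \<phi>st N by simp
    have near: "f u \<le> f (\<phi> r) + e'" if "u \<in> {\<phi> s..\<phi> t}" "r \<in> {s..t}" for u r
    proof -
      have "\<phi> s \<le> \<phi> r" "\<phi> r \<le> \<phi> t"
        using mono_onD[OF \<phi>(2), of s r] mono_onD[OF \<phi>(2), of r t] that st by auto
      hence "dist u (\<phi> r) < d" "u \<in> {0..1}" "\<phi> r \<in> {0..1}"
        using that small \<phi>st by (auto simp: dist_real_def)
      from d(2)[OF this(3,2,1)] show ?thesis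
        by (auto simp: dist_real_def)
    qed
    have "integral {\<phi> s..\<phi> t} f \<le> M * integral {s..t} (\<lambda>r. f (\<phi> r) + e')"
    proof (cases "s = t")
      case False
      hence "s < t" using st by simp
      \<comment> \<open>The mean over the cell dominates \<open>f\<close> on the image of the cell.
        It must be nonnegative, since the image is only known to have length at most
        \<open>M * (t - s)\<close>.\<close>
      define A where "A = integral {s..t} (\<lambda>r. f (\<phi> r) + e') / (t - s)"
      have fu: "f u \<le> A" if "u \<in> {\<phi> s..\<phi> t}" for u
      proof -
        have "integral {s..t} (\<lambda>r. f u) \<le> integral {s..t} (\<lambda>r. f (\<phi> r) + e')"
          by (rule integral_le) (use near that st in \<open>auto intro!: integrable_add int_h\<close>)
        thus ?thesis
          using \<open>s < t\<close> by (simp add: A_def field_simps)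
      qed
      have A0: "0 \<le> A"
        using fu[of "\<phi> s"] f(2)[of "\<phi> s"] \<phi>st by auto
      have "integral {\<phi> s..\<phi> t} f \<le> integral {\<phi> s..\<phi> t} (\<lambda>u. A)"
        by (rule integral_le) (use fu \<phi>st in \<open>auto intro: int_f\<close>)
      also have "\<dots> = A * (\<phi> t - \<phi> s)"
        using \<phi>st by simp
      also have "\<dots> \<le> A * (M * (t - s))"
        by (rule mult_left_mono[OF \<phi>st(4) A0])
      also have "\<dots> = M * integral {s..t} (\<lambda>r. f (\<phi> r) + e')"
        using \<open>s < t\<close> by (simp add: A_def)
      finally show ?thesis .
    qed simp
    also have "\<dots> = M * integral {s..t} (\<lambda>r. f (\<phi> r)) + M * e' * (t - s)"
      using st by (subst integral_add) (auto intro: int_h simp: algebra_simps)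
    finally have "integral {\<phi> s..\<phi> t} f \<le> M * integral {s..t} (\<lambda>r. f (\<phi> r)) + M * e' * (t - s)" .
    moreover have "integral {0..\<phi> s} f + integral {\<phi> s..\<phi> t} f = integral {0..\<phi> t} f"
      by (rule Henstock_Kurzweil_Integration.integral_combine) (use \<phi>st in \<open>auto intro: int_f\<close>)
    moreover have "integral {0..s} (\<lambda>r. f (\<phi> r)) + integral {s..t} (\<lambda>r. f (\<phi> r)) = integral {0..t} (\<lambda>r. f (\<phi> r))"
      by (rule Henstock_Kurzweil_Integration.integral_combine) (use st in \<open>auto intro: int_h\<close>)
    moreover from this have "M * integral {0..t} (\<lambda>r. f (\<phi> r)) =
        M * integral {0..s} (\<lambda>r. f (\<phi> r)) + M * integral {s..t} (\<lambda>r. f (\<phi> r))"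
      by (simp only: distrib_left[symmetric])
    ultimately show ?thesis
      by (simp add: D_def right_diff_distrib)
  qed
  have "D 0 \<le> D (i / N)" if "i \<le> N" for i
    using that
  proof (induction i)
    case (Suc i)
    have "D (i / N) \<le> D (Suc i / N)"
      by (rule step) (use Suc.prems N in \<open>auto simp: field_simps\<close>)
    with Suc show ?case by auto
  qed simp
  from this[of N] have "D 0 \<le> D 1"
    using N by simp
  thus "integral {0..1} f \<le> M * integral {0..1} (\<lambda>t. f (\<phi> t)) + e"
    using e' \<phi> by (simp add: D_def)
qed

section \<open>Constant-speed reparametrisation and its line integrals\<close>

lemma nn_integral_continuous_Icc:
  fixes f :: "real \<Rightarrow> real"
  assumes "continuous_on {a..b} f" "\<And>x. x \<in> {a..b} \<Longrightarrow> 0 \<le> f x"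
  shows "(\<integral>\<^sup>+x\<in>{a..b}. ennreal (f x) \<partial>lborel) = ennreal (integral {a..b} f)"
proof -
  have int: "set_integrable lborel {a..b} f"
    unfolding set_integrable_def by (rule borel_integrable_compact) (use assms in auto)
  have "(\<integral>\<^sup>+x\<in>{a..b}. ennreal (f x) \<partial>lborel) = (\<integral>\<^sup>+x. ennreal (indicator {a..b} x *\<^sub>R f x) \<partial>lborel)"
    by (intro nn_integral_cong) (auto simp: indicator_def)
  also have "\<dots> = ennreal (LINT x:{a..b}|lborel. f x)"
    unfolding set_lebesgue_integral_def
    by (rule nn_integral_eq_integral) (use int assms in \<open>auto simp: set_integrable_def indicator_def\<close>)
  also have "\<dots> = ennreal (integral {a..b} f)"
    using set_borel_integral_eq_integral(2)[OF int] by simp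
  finally show ?thesis .
qed

lemma borel_measurable_ennreal_continuous_on:
  fixes f :: "'b::topological_space \<Rightarrow> real"
  assumes "A \<in> sets borel" "continuous_on A f"
  shows "(\<lambda>s. ennreal (f s) * indicator A s) \<in> borel_measurable borel"
proof -
  have "(\<lambda>s. ennreal (indicator A s *\<^sub>R f s)) \<in> borel_measurable borel"
    by (intro measurable_compose[OF borel_measurable_continuous_on_indicator[OF assms]]) auto
  also have "(\<lambda>s. ennreal (indicator A s *\<^sub>R f s)) = (\<lambda>s. ennreal (f s) * indicator A s)"
    by (auto simp: indicator_def)
  finally show ?thesis .
qed

text \<open>Everything is read off the arc length \<open>e\<close>; normalised by the positive total
  length it becomes the time change \<phi> between the given and the constant-speed
  parametrisation.\<close>

lemma const_speed_lipschitz_curve: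
  fixes \<gamma> :: "real \<Rightarrow> 'a::metric_space"
  assumes lip: "L-lipschitz_on {0..1} \<gamma>" and len: "0 < curve_length \<gamma>"
  obtains \<phi> l where "0 < l" "curve_length \<gamma> = ennreal l" "(L / l)-lipschitz_on {0..1} \<phi>"
    "mono_on {0..1} \<phi>" "\<phi> 0 = 0" "\<phi> 1 = 1"
    "\<And>t. t \<in> {0..1} \<Longrightarrow> const_speed \<gamma> (\<phi> t) = \<gamma> t"
    "l-lipschitz_on {0..1} (const_speed \<gamma>)"
proof -
  have L0: "0 \<le> L"
    using lip by (rule lipschitz_on_nonneg)
  have lip': "L-lipschitz_on {0..t} \<gamma>" if "t \<le> 1" for t
    by (rule lipschitz_on_subset[OF lip]) (use that in auto)
  define e where "e t = enn2real (curve_length_on \<gamma> 0 t)" for t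
  have e: "curve_length_on \<gamma> 0 t = ennreal (e t)" if "t \<in> {0..1}" for t
  proof -
    have "curve_length_on \<gamma> 0 t < \<infinity>"
      by (rule order.strict_trans1[OF curve_length_on_lipschitz[OF lip'[of t]]]) (use that in auto)
    thus ?thesis by (simp add: e_def)
  qed
  have e_nonneg: "0 \<le> e t" for t
    by (simp add: e_def)
  have e_0: "e 0 = 0"
    using curve_length_on_lipschitz[OF lip'[of 0]] by (simp add: e_def)
  have e_dist: "e s + dist (\<gamma> s) (\<gamma> t) \<le> e t" if "0 \<le> s" "s \<le> t" "t \<le> 1" for s t
    using curve_length_on_add_dist[of 0 s t \<gamma>] that e_nonneg
    by (simp add: e ennreal_plus[symmetric] del: ennreal_plus)
  have e_lip: "e t \<le> e s + L * (t - s)" if "0 \<le> s" "s \<le> t" "t \<le> 1" for s t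
    using curve_length_on_le_add_lipschitz[OF lip'[OF that(3)] that(1,2)] that e_nonneg L0
    by (simp add: e ennreal_plus[symmetric] del: ennreal_plus)
  define l where "l = e 1"
  have cl: "curve_length \<gamma> = ennreal l"
    by (simp add: curve_length_def e l_def)
  hence l0: "0 < l"
    using len by simp
  define \<phi> where "\<phi> t = e t / l" for t
  have e_mono: "e s \<le> e t" if "0 \<le> s" "s \<le> t" "t \<le> 1" for s t
    using e_dist[OF that] zero_le_dist[of "\<gamma> s" "\<gamma> t"] by linarith
  have \<phi>_lip: "(L / l)-lipschitz_on {0..1} \<phi>"
  proof (rule lipschitz_on_leI)
    fix s t :: real assume "s \<in> {0..1}" "t \<in> {0..1}" "s \<le> t"
    hence "\<bar>e s - e t\<bar> \<le> L * (t - s)"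
      using e_mono[of s t] e_lip[of s t] by auto
    thus "dist (\<phi> s) (\<phi> t) \<le> L / l * dist s t"
      using l0 \<open>s \<le> t\<close> by (simp add: \<phi>_def dist_real_def field_simps flip: diff_divide_distrib)
  qed (use L0 l0 in auto)
  have \<phi>_mono: "mono_on {0..1} \<phi>"
    using l0 e_mono by (intro mono_onI) (auto simp: \<phi>_def divide_right_mono)
  have cs: "\<exists>t\<in>{0..1}. const_speed \<gamma> s = \<gamma> t \<and> e t = s * l" if s: "s \<in> {0..1}" for s
  proof -
    \<comment> \<open>Arc length is continuous and runs from 0 to \<open>l\<close>, so the
      \<open>SOME\<close> in \<open>const_speed\<close> always has a witness.\<close>
    have "\<exists>t. 0 \<le> t \<and> t \<le> 1 \<and> \<phi> t = s"
      by (rule IVT') (use s l0 lipschitz_on_continuous_on[OF \<phi>_lip] in \<open>auto simp: \<phi>_def e_0 l_def\<close>)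
    then obtain t0 where t0: "t0 \<in> {0..1}" "\<phi> t0 = s"
      by auto
    have "e t0 = s * l"
      using t0 l0 by (auto simp: \<phi>_def)
    hence "t0 \<in> {0..1} \<and> curve_length_on \<gamma> 0 t0 = ennreal s * curve_length \<gamma>"
      using t0 s l0 by (simp add: e cl ennreal_mult)
    hence t: "(SOME t. t \<in> {0..1} \<and> curve_length_on \<gamma> 0 t = ennreal s * curve_length \<gamma>) \<in> {0..1} \<and>
        curve_length_on \<gamma> 0 (SOME t. t \<in> {0..1} \<and> curve_length_on \<gamma> 0 t = ennreal s * curve_length \<gamma>)
          = ennreal s * curve_length \<gamma>" (is "?t \<in> _ \<and> _")
      by (rule someI)
    hence "ennreal (e ?t) = ennreal (s * l)"
      using e[of ?t] s l0 by (simp add: cl ennreal_mult)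
    hence "e ?t = s * l"
      using e_nonneg[of ?t] s l0 by (simp add: ennreal_inj)
    thus ?thesis
      using t unfolding const_speed_def by blast
  qed
  \<comment> \<open>The curve does not move while its arc length stands still. Hence the time chosen
    by \<open>SOME\<close> is immaterial, and the chosen points vary with Lipschitz constant
    \<open>l\<close>.\<close>
  have dist_e: "dist (\<gamma> s) (\<gamma> t) \<le> \<bar>e s - e t\<bar>" if "s \<in> {0..1}" "t \<in> {0..1}" for s t
    using e_dist[of s t] e_dist[of t s] that by (cases "s \<le> t") (auto simp: dist_commute)
  have \<phi>01: "\<phi> t \<in> {0..1}" if "t \<in> {0..1}" for t
    using e_mono[of t 1] that e_nonneg l0 by (auto simp: \<phi>_def l_def)
  show ?thesis
  proof (rule that[OF l0 cl \<phi>_lip \<phi>_mono])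
    show "\<phi> 0 = 0" "\<phi> 1 = 1"
      using l0 by (auto simp: \<phi>_def e_0 l_def)
  next
    fix t :: real assume "t \<in> {0..1}"
    thus "const_speed \<gamma> (\<phi> t) = \<gamma> t"
    proof -
      obtain t' where t': "t' \<in> {0..1}" "const_speed \<gamma> (\<phi> t) = \<gamma> t'" "e t' = \<phi> t * l"
        using cs[of "\<phi> t"] \<phi>01[of t] \<open>t \<in> {0..1}\<close> by auto
      thus ?thesis
        using dist_e[OF t'(1), of t] \<open>t \<in> {0..1}\<close> l0 by (simp add: \<phi>_def)
    qed
  next
    show "l-lipschitz_on {0..1} (const_speed \<gamma>)"
    proof (rule lipschitz_onI)
      fix x y :: real assume "x \<in> {0..1}" "y \<in> {0..1}"
      then obtain t u where "t \<in> {0..1}" "u \<in> {0..1}" "const_speed \<gamma> x = \<gamma> t" "const_speed \<gamma> y = \<gamma> u"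
        "e t = x * l" "e u = y * l"
        using cs by metis
      thus "dist (const_speed \<gamma> x) (const_speed \<gamma> y) \<le> l * dist x y"
        using dist_e[of t u] l0 by (simp add: dist_real_def abs_mult mult.commute[of l] flip: left_diff_distrib)
    qed (use l0 in auto)
  qed
qed

text \<open>This direction is the useful one: admissibility bounds the constant-speed integral from
  below, while a limit of paths comes with an upper bound in its own parametrisation, whose speed
  may vary.\<close>

lemma line_integral_continuous_le:
  fixes \<gamma> :: "real \<Rightarrow> 'a::metric_space" and g :: "'a \<Rightarrow> real"
  assumes lip: "L-lipschitz_on {0..1} \<gamma>" and len: "0 < curve_length \<gamma>"
    and g: "continuous_on UNIV g" "\<And>x. 0 \<le> g x"
  shows "curve_length \<gamma> * (\<integral>\<^sup>+t\<in>{0..1}. ennreal (g (const_speed \<gamma> t)) \<partial>lborel)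
    \<le> ennreal L * (\<integral>\<^sup>+t\<in>{0..1}. ennreal (g (\<gamma> t)) \<partial>lborel)"
proof -
  obtain \<phi> l where l: "0 < l" "curve_length \<gamma> = ennreal l"
    and \<phi>: "(L / l)-lipschitz_on {0..1} \<phi>" "mono_on {0..1} \<phi>" "\<phi> 0 = 0" "\<phi> 1 = 1"
    and cs: "\<And>t. t \<in> {0..1} \<Longrightarrow> const_speed \<gamma> (\<phi> t) = \<gamma> t"
    and csl: "l-lipschitz_on {0..1} (const_speed \<gamma>)"
    using const_speed_lipschitz_curve[OF lip len] by metis
  have L0: "0 \<le> L"
    using lip by (rule lipschitz_on_nonneg)
  have cont: "continuous_on {0..1} (\<lambda>t. g (\<sigma> t))" if "M-lipschitz_on {0..1} \<sigma>" for \<sigma> :: "real \<Rightarrow> 'a" and M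
    by (rule continuous_on_compose2[OF g(1) lipschitz_on_continuous_on[OF that]]) auto
  have "integral {0..1} (\<lambda>t. g (const_speed \<gamma> t)) \<le> L / l * integral {0..1} (\<lambda>t. g (const_speed \<gamma> (\<phi> t)))"
    by (rule integral_le_mono_lipschitz[OF cont[OF csl] _ \<phi>]) (rule g)
  also have "integral {0..1} (\<lambda>t. g (const_speed \<gamma> (\<phi> t))) = integral {0..1} (\<lambda>t. g (\<gamma> t))"
    by (rule integral_cong) (simp add: cs)
  finally have "l * integral {0..1} (\<lambda>t. g (const_speed \<gamma> t)) \<le> L * integral {0..1} (\<lambda>t. g (\<gamma> t))"
    using l by (simp add: field_simps)
  thus ?thesis
    using l L0 g cont[OF csl] cont[OF lip]
    by (simp add: nn_integral_continuous_Icc ennreal_mult'[symmetric] ennreal_leI)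
qed

text \<open>The substitution \<open>a + c * t\<close> runs the curve forwards or backwards, for
  curves that start or end in the given set. The supremum of the weights need not be continuous, so
  the comparison is made for each \<open>g n\<close> and passed on by monotone convergence.\<close>

lemma line_integral_lipschitz_le:
  fixes v :: "real \<Rightarrow> 'a::metric_space" and g :: "nat \<Rightarrow> 'a \<Rightarrow> real"
  assumes L: "0 \<le> L" and v: "1-lipschitz_on {0..L} v" "v 0 \<noteq> v L"
    and ac: "a = 0 \<and> c = L \<or> a = L \<and> c = - L"
    and g: "\<And>n. continuous_on UNIV (g n)" "\<And>n x. 0 \<le> g n x" "\<And>x. incseq (\<lambda>n. g n x)"
    and \<rho>: "\<And>x. \<rho> x \<le> (SUP n. ennreal (g n x))"
  shows "line_integral (\<lambda>t. v (a + c * t)) \<rho> \<le> (\<integral>\<^sup>+s\<in>{0..L}. (SUP n. ennreal (g n (v s))) \<partial>lborel)"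
proof -
  define \<gamma> where "\<gamma> t = v (a + c * t)" for t
  have L0: "0 < L"
    using L v(2) by (cases "L = 0") auto
  have ind: "indicator {0..L} (a + c * t) = (indicator {0..1} t :: ennreal)" for t
    using ac L0 by (auto simp: indicator_def field_simps zero_le_mult_iff)
  have in_dom: "a + c * t \<in> {0..L}" if "t \<in> {0..1}" for t
    using ind[of t] that by (auto simp: indicator_def split: if_splits)
  have lip: "L-lipschitz_on {0..1} \<gamma>"
  proof (rule lipschitz_onI[OF _ L])
    fix s t :: real assume "s \<in> {0..1}" "t \<in> {0..1}"
    hence "dist (\<gamma> s) (\<gamma> t) \<le> \<bar>c * s - c * t\<bar>"
      using lipschitz_onD[OF v(1) in_dom in_dom, of s t] by (simp add: \<gamma>_def dist_real_def)
    also have "\<dots> = \<bar>c\<bar> * \<bar>s - t\<bar>"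
      by (simp only: right_diff_distrib[symmetric] abs_mult)
    also have "\<dots> = L * dist s t"
      using ac L by (auto simp: dist_real_def)
    finally show "dist (\<gamma> s) (\<gamma> t) \<le> L * dist s t" .
  qed
  have "\<gamma> 0 \<noteq> \<gamma> 1"
    using ac v(2) by (auto simp: \<gamma>_def)
  hence "0 < ennreal (dist (\<gamma> 0) (\<gamma> 1))"
    by simp
  also have "\<dots> \<le> curve_length \<gamma>"
    by (rule dist_le_curve_length)
  finally have len: "0 < curve_length \<gamma>" .
  have fin: "curve_length \<gamma> < \<infinity>"
    unfolding curve_length_def by (rule order.strict_trans1[OF curve_length_on_lipschitz[OF lip]]) simp
  obtain l where csl: "l-lipschitz_on {0..1} (const_speed \<gamma>)"
    using const_speed_lipschitz_curve[OF lip len] by metis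
  have "continuous_on {0..1} (\<lambda>t. g n (const_speed \<gamma> t))" for n
    by (rule continuous_on_compose2[OF g(1) lipschitz_on_continuous_on[OF csl]]) auto
  hence [measurable]: "(\<lambda>t. ennreal (g n (const_speed \<gamma> t)) * indicator {0..1} t) \<in> borel_measurable borel" for n
    by (intro borel_measurable_ennreal_continuous_on) auto
  have "continuous_on {0..L} (\<lambda>s. g n (v s))" for n
    by (rule continuous_on_compose2[OF g(1) lipschitz_on_continuous_on[OF v(1)]]) auto
  hence v_meas: "(\<lambda>s. ennreal (g n (v s)) * indicator {0..L} s) \<in> borel_measurable borel" for n
    by (intro borel_measurable_ennreal_continuous_on) auto
  have bound: "curve_length \<gamma> * (\<integral>\<^sup>+t\<in>{0..1}. ennreal (g n (const_speed \<gamma> t)) \<partial>lborel)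
      \<le> (\<integral>\<^sup>+s\<in>{0..L}. (SUP n. ennreal (g n (v s))) \<partial>lborel)" for n
  proof -
    have "curve_length \<gamma> * (\<integral>\<^sup>+t\<in>{0..1}. ennreal (g n (const_speed \<gamma> t)) \<partial>lborel)
        \<le> ennreal L * (\<integral>\<^sup>+t\<in>{0..1}. ennreal (g n (\<gamma> t)) \<partial>lborel)"
      by (rule line_integral_continuous_le[OF lip len g(1,2)])
    \<comment> \<open>\<open>\<bar>c\<bar> = L\<close> is the Jacobian of the substitution in both
      directions.\<close>
    also have "ennreal L = ennreal \<bar>c\<bar>"
      using ac L by auto
    also have "ennreal \<bar>c\<bar> * (\<integral>\<^sup>+t\<in>{0..1}. ennreal (g n (\<gamma> t)) \<partial>lborel)
        = (\<integral>\<^sup>+s\<in>{0..L}. ennreal (g n (v s)) \<partial>lborel)"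
      using ac L0 by (subst nn_integral_real_affine[OF v_meas[of n], of c a]) (auto simp: ind \<gamma>_def)
    also have "\<dots> \<le> (\<integral>\<^sup>+s\<in>{0..L}. (SUP n. ennreal (g n (v s))) \<partial>lborel)"
      by (intro nn_integral_mono mult_right_mono SUP_upper) auto
    finally show ?thesis .
  qed
  have "line_integral \<gamma> \<rho> \<le> curve_length \<gamma> *
      (\<integral>\<^sup>+t\<in>{0..1}. (SUP n. ennreal (g n (const_speed \<gamma> t))) \<partial>lborel)"
    using fin by (simp add: line_integral_def mult_left_mono nn_integral_mono mult_right_mono \<rho>)
  also have "(\<integral>\<^sup>+t\<in>{0..1}. (SUP n. ennreal (g n (const_speed \<gamma> t))) \<partial>lborel)
      = (\<integral>\<^sup>+t. (SUP n. ennreal (g n (const_speed \<gamma> t)) * indicator {0..1} t) \<partial>lborel)"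
    by (simp add: SUP_mult_right_ennreal)
  also have "\<dots> = (SUP n. \<integral>\<^sup>+t\<in>{0..1}. ennreal (g n (const_speed \<gamma> t)) \<partial>lborel)"
    by (intro nn_integral_monotone_convergence_SUP incseq_SucI le_funI mult_right_mono
        ennreal_leI incseq_SucD[OF g(3)] zero_le) simp
  also have "curve_length \<gamma> * \<dots> \<le> (\<integral>\<^sup>+s\<in>{0..L}. (SUP n. ennreal (g n (v s))) \<partial>lborel)"
    by (subst SUP_mult_left_ennreal) (intro SUP_least bound)
  finally show "line_integral (\<lambda>t. v (a + c * t)) \<rho> \<le> (\<integral>\<^sup>+s\<in>{0..L}. (SUP n. ennreal (g n (v s))) \<partial>lborel)"
    by (simp add: \<gamma>_def[abs_def])
qed

section \<open>Discrete exit costs and their potential\<close>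

text \<open>A Riemann sum of \<open>g\<close> along a chain with jumps shorter than
  \<open>r\<close>, the weight being taken at the start of each step. The recursive form turns every
  short step into an inequality for the infimum.\<close>

inductive exit_cost :: "('a::metric_space \<Rightarrow> real) \<Rightarrow> 'a set \<Rightarrow> real \<Rightarrow> 'a \<Rightarrow> real \<Rightarrow> bool"
  for g :: "'a \<Rightarrow> real" and U :: "'a set" and r :: real where
  outside: "x \<notin> U \<Longrightarrow> exit_cost g U r x 0"
| step: "dist x y < r \<Longrightarrow> exit_cost g U r y c \<Longrightarrow> exit_cost g U r x (g x * dist x y + c)"

text \<open>The inserted 1 caps the potential and keeps the infimum meaningful when no chain leads
  out of \<open>U\<close>, as can happen in a disconnected space.\<close>

definition exit_potential :: "('a::metric_space \<Rightarrow> real) \<Rightarrow> 'a set \<Rightarrow> real \<Rightarrow> 'a \<Rightarrow> real" where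
  "exit_potential g U r x = Inf (insert 1 {c. exit_cost g U r x c})"

lemma exit_cost_nonneg:
  assumes "exit_cost g U r x c" "\<And>x. 0 \<le> g x"
  shows "0 \<le> c"
  using assms by induction auto

context
  fixes g :: "'a::metric_space \<Rightarrow> real" and U :: "'a set" and r :: real
  assumes g_nonneg: "\<And>x. 0 \<le> g x"
begin

lemma exit_potential_bdd: "bdd_below (insert 1 {c. exit_cost g U r x c})"
  using exit_cost_nonneg[OF _ g_nonneg] by (intro bdd_belowI[of _ 0]) auto

lemma exit_potential_nonneg: "0 \<le> exit_potential g U r x"
  unfolding exit_potential_def
  by (rule cInf_greatest) (use exit_cost_nonneg[OF _ g_nonneg] in auto)

lemma exit_potential_le_1: "exit_potential g U r x \<le> 1"
  unfolding exit_potential_def by (rule cInf_lower[OF _ exit_potential_bdd]) auto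

lemma exit_potential_le_cost: "exit_cost g U r x c \<Longrightarrow> exit_potential g U r x \<le> c"
  unfolding exit_potential_def by (rule cInf_lower[OF _ exit_potential_bdd]) auto

lemma exit_potential_outside: "x \<notin> U \<Longrightarrow> exit_potential g U r x = 0"
  using exit_potential_le_cost[OF exit_cost.outside] exit_potential_nonneg[of x] by fastforce

lemma exit_potential_ge:
  assumes "\<And>c. exit_cost g U r x c \<Longrightarrow> a \<le> c" "a \<le> 1"
  shows "a \<le> exit_potential g U r x"
  unfolding exit_potential_def by (rule cInf_greatest) (use assms in auto)

lemma exit_potential_step:
  assumes "dist x y < r"
  shows "exit_potential g U r x \<le> g x * dist x y + exit_potential g U r y"
proof -
  have "exit_potential g U r x - g x * dist x y \<le> exit_potential g U r y"
  proof (rule exit_potential_ge)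
    fix c assume "exit_cost g U r y c"
    from exit_potential_le_cost[OF exit_cost.step[OF assms this]]
    show "exit_potential g U r x - g x * dist x y \<le> c" by simp
  next
    show "exit_potential g U r x - g x * dist x y \<le> 1"
      using exit_potential_le_1[of x] g_nonneg[of x] by (smt (verit) zero_le_dist mult_nonneg_nonneg)
  qed
  thus ?thesis by simp
qed

lemma exit_potential_diff_le:
  assumes "dist x y < r"
  shows "\<bar>exit_potential g U r x - exit_potential g U r y\<bar> \<le> max (g x) (g y) * dist x y"
proof -
  have "g x * dist x y \<le> max (g x) (g y) * dist x y" "g y * dist x y \<le> max (g x) (g y) * dist x y"
    by (auto intro: mult_right_mono)
  moreover have "exit_potential g U r y \<le> g y * dist x y + exit_potential g U r x"
    using exit_potential_step[of y x] assms by (simp add: dist_commute)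
  ultimately show ?thesis
    using exit_potential_step[OF assms] by (simp add: abs_le_iff)
qed

text \<open>Points less than \<open>r\<close> apart are joined by one step, which gives the slope
  \<open>B\<close>; for the others the total oscillation of at most 1 gives the slope
  \<open>1 / r\<close>.\<close>

lemma exit_potential_lipschitz:
  assumes r: "0 < r" and B: "\<And>x. g x \<le> B"
  shows "(max B (1 / r))-lipschitz_on UNIV (exit_potential g U r)"
proof (rule lipschitz_onI)
  fix x y
  show "dist (exit_potential g U r x) (exit_potential g U r y) \<le> max B (1 / r) * dist x y"
  proof (cases "dist x y < r")
    case True
    have "max (g x) (g y) * dist x y \<le> max B (1 / r) * dist x y"
      using B[of x] B[of y] by (intro mult_right_mono) auto
    thus ?thesis
      using exit_potential_diff_le[OF True] by (simp add: dist_real_def)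
  next
    case False
    have "\<bar>exit_potential g U r x - exit_potential g U r y\<bar> \<le> 1"
      using exit_potential_nonneg[of x] exit_potential_nonneg[of y]
        exit_potential_le_1[of x] exit_potential_le_1[of y] by linarith
    also have "1 \<le> 1 / r * dist x y"
      using False r by (simp add: field_simps)
    also have "\<dots> \<le> max B (1 / r) * dist x y"
      by (intro mult_right_mono) auto
    finally show ?thesis
      by (simp add: dist_real_def)
  qed
qed (use r in \<open>auto simp: le_max_iff_disj\<close>)

lemma exit_potential_LIP_bs:
  assumes "0 < r" "\<And>x. g x \<le> B" "bounded U"
  shows "exit_potential g U r \<in> LIP_bs"
proof -
  have "bounded (range (exit_potential g U r))"
    by (rule bounded_subset[of "{0..1}"]) (use exit_potential_nonneg exit_potential_le_1 in auto)
  moreover have "bounded {x. exit_potential g U r x \<noteq> 0}"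
    by (rule bounded_subset[OF assms(3)]) (use exit_potential_outside in auto)
  ultimately show ?thesis
    using exit_potential_lipschitz[OF assms(1,2)] by (auto simp: LIP_bs_def)
qed

end

section \<open>Asymptotic slope of the potential\<close>

lemma lip_a_le:
  assumes L: "L-lipschitz_on UNIV f" and "0 < d" and "0 \<le> a"
    and le: "\<And>y z. \<lbrakk>y \<in> ball x d; z \<in> ball x d\<rbrakk> \<Longrightarrow> \<bar>f y - f z\<bar> \<le> a * dist y z"
  shows "lip_a f x \<le> a"
proof (cases "x islimpt UNIV")
  case True
  define Q where "Q r = {\<bar>f y - f z\<bar> / dist y z | y z. y \<in> ball x r \<and> z \<in> ball x r \<and> y \<noteq> z}" for r
  have ne: "Q r \<noteq> {}" if "0 < r" for r
  proof -
    obtain y where "y \<in> ball x r" "y \<noteq> x"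
      using True \<open>0 < r\<close> unfolding islimpt_def by (metis UNIV_I centre_in_ball open_ball)
    moreover have "x \<in> ball x r"
      using \<open>0 < r\<close> by simp
    ultimately show ?thesis
      unfolding Q_def by blast
  qed
  \<comment> \<open>The real \<open>Sup\<close> and \<open>Inf\<close> in \<open>lip_a\<close> are
    informative only for nonempty bounded sets: the global constant \<open>L\<close> gives the upper
    bounds, the accumulation point gives the pairs.\<close>
  have bdd: "bdd_above (Q r)" for r
  proof (rule bdd_aboveI)
    fix t assume "t \<in> Q r"
    then obtain y z where "t = \<bar>f y - f z\<bar> / dist y z" "y \<noteq> z"
      by (auto simp: Q_def)
    thus "t \<le> L"
      using lipschitz_onD[OF L, of y z] by (simp add: divide_le_eq dist_real_def)
  qed
  have nonneg: "0 \<le> Sup (Q r)" if "0 < r" for r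
  proof -
    obtain t where t: "t \<in> Q r"
      using ne[OF \<open>0 < r\<close>] by auto
    hence "0 \<le> t"
      by (auto simp: Q_def)
    also have "t \<le> Sup (Q r)"
      by (rule cSup_upper[OF t bdd])
    finally show ?thesis .
  qed
  have "lip_a f x = Inf ((\<lambda>r. Sup (Q r)) ` {0<..})"
    using True by (simp add: lip_a_def Q_def)
  also have "\<dots> \<le> Sup (Q d)"
    by (rule cInf_lower) (use nonneg \<open>0 < d\<close> in \<open>auto intro!: bdd_belowI[of _ 0]\<close>)
  also have "\<dots> \<le> a"
    by (rule cSup_least[OF ne[OF \<open>0 < d\<close>]]) (use le in \<open>auto simp: Q_def field_simps\<close>)
  finally show ?thesis .
qed (use \<open>0 \<le> a\<close> in \<open>simp add: lip_a_def\<close>)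

text \<open>Two points within \<open>r / 2\<close> of \<open>x\<close> are one step apart, so their
  difference quotient is at most the larger of their weights, which continuity brings down to
  \<open>g x\<close>. The closure enters because the slope may be nonzero at boundary points of
  \<open>U\<close>.\<close>

lemma lip_a_exit_potential_le:
  assumes g: "\<And>x. 0 \<le> g x" "\<And>x. g x \<le> B" "continuous_on UNIV g" and r: "0 < r"
  shows "lip_a (exit_potential g U r) x \<le> g x * indicator (closure U) x"
proof (cases "x \<in> closure U")
  case False
  then obtain d where d: "0 < d" "ball x d \<subseteq> - closure U"
    by (metis ComplI closed_closure open_Compl openE)
  have "lip_a (exit_potential g U r) x \<le> 0"
  proof (rule lip_a_le[OF exit_potential_lipschitz[OF g(1) r g(2)] d(1)])
    fix y z assume "y \<in> ball x d" "z \<in> ball x d"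
    hence "y \<notin> U" "z \<notin> U"
      using d closure_subset by blast+
    thus "\<bar>exit_potential g U r y - exit_potential g U r z\<bar> \<le> 0 * dist y z"
      by (simp add: exit_potential_outside[OF g(1)])
  qed simp
  thus ?thesis
    using False by simp
next
  case True
  have "lip_a (exit_potential g U r) x \<le> g x"
  proof (rule field_le_epsilon)
    fix e :: real assume "0 < e"
    obtain d where d: "0 < d" "\<And>y. dist y x < d \<Longrightarrow> dist (g y) (g x) < e"
      using g(3) \<open>0 < e\<close> by (metis UNIV_I continuous_on_iff)
    show "lip_a (exit_potential g U r) x \<le> g x + e"
    proof (rule lip_a_le[OF exit_potential_lipschitz[OF g(1) r g(2)], of "min d (r / 2)"])
      fix y z assume yz: "y \<in> ball x (min d (r / 2))" "z \<in> ball x (min d (r / 2))"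
      hence "dist y z < r"
        using dist_triangle2[of y z x] by (auto simp: dist_commute)
      hence 1: "\<bar>exit_potential g U r y - exit_potential g U r z\<bar> \<le> max (g y) (g z) * dist y z"
        by (rule exit_potential_diff_le[OF g(1)])
      have "dist (g y) (g x) < e" "dist (g z) (g x) < e"
        by (rule d(2), use yz in \<open>simp add: dist_commute\<close>)+
      hence "max (g y) (g z) \<le> g x + e"
        by (auto simp: dist_real_def abs_less_iff)
      from order_trans[OF 1 mult_right_mono[OF this zero_le_dist]]
      show "\<bar>exit_potential g U r y - exit_potential g U r z\<bar> \<le> (g x + e) * dist y z" .
    qed (use d r g(1)[of x] \<open>0 < e\<close> in auto)
  qed
  thus ?thesis
    using True by simp
qed

text \<open>A chain in continuous time: the path waits at each point for as long as the next step is
  long, then jumps. Its cost becomes a time integral, and it is 1-Lipschitz up to an error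
  \<open>r\<close>. Waiting before jumping keeps the estimate from time 0 free of this error, which
  stops errors from accumulating in the induction.\<close>

definition exit_path ::
  "('a::metric_space \<Rightarrow> real) \<Rightarrow> 'a set \<Rightarrow> real \<Rightarrow> 'a \<Rightarrow> real \<Rightarrow> (real \<Rightarrow> 'a) \<Rightarrow> real \<Rightarrow> bool" where
  "exit_path g U r x c w L \<longleftrightarrow>
    0 \<le> L \<and> w 0 = x \<and> (\<forall>s\<ge>L. w s = w L) \<and> w L \<notin> U \<and> w \<in> borel_measurable borel \<and>
    (\<forall>t\<ge>0. dist x (w t) \<le> t) \<and> (\<forall>s\<ge>0. \<forall>t\<ge>s. dist (w s) (w t) \<le> t - s + r) \<and>
    (\<integral>\<^sup>+s\<in>{0..L}. ennreal (g (w s)) \<partial>lborel) \<le> ennreal c"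

lemma exit_pathD:
  assumes "exit_path g U r x c w L"
  shows "0 \<le> L" "w 0 = x" "w L \<notin> U" "w \<in> borel_measurable borel"
    and "\<And>s. L \<le> s \<Longrightarrow> w s = w L"
    and "\<And>t. 0 \<le> t \<Longrightarrow> dist x (w t) \<le> t"
    and "\<And>s t. \<lbrakk>0 \<le> s; s \<le> t\<rbrakk> \<Longrightarrow> dist (w s) (w t) \<le> t - s + r"
    and "(\<integral>\<^sup>+s\<in>{0..L}. ennreal (g (w s)) \<partial>lborel) \<le> ennreal c"
  using assms unfolding exit_path_def by blast+

lemma exit_cost_path:
  fixes g :: "'a::{metric_space,second_countable_topology} \<Rightarrow> real"
  assumes "exit_cost g U r x c" and g: "\<And>x. 0 \<le> g x" "continuous_on UNIV g" and r: "0 < r"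
  shows "\<exists>w L. exit_path g U r x c w L"
  using assms(1)
proof induction
  case (outside x)
  have "(\<integral>\<^sup>+s\<in>{0..0::real}. ennreal (g x) \<partial>lborel) = 0"
    by (simp add: nn_integral_cmult_indicator)
  thus ?case
    using outside r by (intro exI[of _ "\<lambda>_. x"] exI[of _ 0]) (auto simp: exit_path_def)
next
  case (step x y c)
  have [measurable]: "g \<in> borel_measurable borel"
    using g(2) by (rule borel_measurable_continuous_onI)
  define d where "d = dist x y"
  have d: "0 \<le> d" "d < r"
    using step.hyps by (auto simp: d_def)
  from step.IH obtain w L where "exit_path g U r y c w L"
    by blast
  note w = exit_pathD[OF this]
  note [measurable] = w(4)
  define w' where "w' s = (if s < d then x else w (s - d))" for s
  have dx: "dist x (w (t - d)) \<le> t" if "d \<le> t" for t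
    using dist_triangle[of x "w (t - d)" y] w(6)[of "t - d"] that by (simp add: d_def)
  have c: "0 \<le> c"
    by (rule exit_cost_nonneg[OF step.hyps(2) g(1)])
  have "(\<integral>\<^sup>+s\<in>{0..L + d}. ennreal (g (w' s)) \<partial>lborel)
      \<le> (\<integral>\<^sup>+s. ennreal (g x) * indicator {0..d} s + ennreal (g (w (s - d))) * indicator {0..L} (s - d) \<partial>lborel)"
    by (intro nn_integral_mono) (auto simp: w'_def indicator_def)
  also have "\<dots> = ennreal (g x) * ennreal d + (\<integral>\<^sup>+s. ennreal (g (w (s - d))) * indicator {0..L} (s - d) \<partial>lborel)"
    using d by (subst nn_integral_add) (auto simp: nn_integral_cmult_indicator)
  also have "(\<integral>\<^sup>+s. ennreal (g (w (s - d))) * indicator {0..L} (s - d) \<partial>lborel)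
      = (\<integral>\<^sup>+s\<in>{0..L}. ennreal (g (w s)) \<partial>lborel)"
    using nn_integral_real_affine[of "\<lambda>s. ennreal (g (w s)) * indicator {0..L} s" 1 "- d"] by simp
  also have "ennreal (g x) * ennreal d + \<dots> \<le> ennreal (g x * d + c)"
    using w(8) g(1)[of x] d c by (simp add: ennreal_mult)
  finally have int: "(\<integral>\<^sup>+s\<in>{0..L + d}. ennreal (g (w' s)) \<partial>lborel) \<le> ennreal (g x * d + c)" .
  have "exit_path g U r x (g x * dist x y + c) w' (L + d)"
    unfolding exit_path_def
  proof (intro conjI allI impI)
    show "w' 0 = x"
      using d w(2) by (auto simp: w'_def d_def)
    show "w' s = w' (L + d)" if "L + d \<le> s" for s
      using w(5)[of "s - d"] that w(1) by (simp add: w'_def)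
    show "w' \<in> borel_measurable borel"
      unfolding w'_def by measurable
    show "dist x (w' t) \<le> t" if "0 \<le> t" for t
      using dx[of t] that by (simp add: w'_def)
    \<comment> \<open>If the jump lies between \<open>s\<close> and \<open>t\<close>, then
      \<open>dist x (w (t - d)) \<le> t = (t - s) + s\<close> and \<open>s < d < r\<close>.\<close>
    show "dist (w' s) (w' t) \<le> t - s + r" if "0 \<le> s" "s \<le> t" for s t
      using dx[of t] w(7)[of "s - d" "t - d"] that d r by (auto simp: w'_def)
    show "(\<integral>\<^sup>+s\<in>{0..L + d}. ennreal (g (w' s)) \<partial>lborel) \<le> ennreal (g x * dist x y + c)"
      using int by (simp add: d_def)
    show "0 \<le> L + d" "w' (L + d) \<notin> U"
      using w(1,3) d by (auto simp: w'_def)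
  qed
  thus ?case
    by blast
qed

section \<open>Limits of cheap paths\<close>

text \<open>Total boundedness: a tail of the sequence is caught by enlarged balls around a finite
  net of \<open>C\<close>, and only finitely many terms remain.\<close>

lemma compact_closure_range_if_near_compact:
  fixes z :: "nat \<Rightarrow> 'a::complete_space"
  assumes near: "\<And>e. 0 < e \<Longrightarrow> \<exists>C. compact C \<and> C \<noteq> {} \<and> (\<forall>\<^sub>F n in sequentially. infdist (z n) C < e)"
  shows "compact (closure (range z))"
  unfolding compact_eq_totally_bounded
proof (intro conjI allI impI)
  show "complete (closure (range z))"
    by (simp add: complete_eq_closed)
  fix e :: real assume "0 < e"
  hence e3: "0 < e / 3" by simp
  obtain C N where C: "compact C" "C \<noteq> {}" "\<And>n. N \<le> n \<Longrightarrow> infdist (z n) C < e / 3"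
    using near[OF e3] unfolding eventually_sequentially by blast
  obtain k where k: "finite k" "C \<subseteq> (\<Union>x\<in>k. ball x (e / 3))"
    using C(1) e3 unfolding compact_eq_totally_bounded by blast
  have "range z \<subseteq> (\<Union>x\<in>k \<union> z ` {..<N}. ball x (2 * e / 3))"
  proof
    fix y assume "y \<in> range z"
    then obtain n where n: "y = z n" by blast
    show "y \<in> (\<Union>x\<in>k \<union> z ` {..<N}. ball x (2 * e / 3))"
    proof (cases "n < N")
      case True
      thus ?thesis using n \<open>0 < e\<close> by force
    next
      case False
      hence "(INF a\<in>C. dist (z n) a) < e / 3"
        using C(2) C(3)[of n] by (simp add: infdist_notempty)
      then obtain a where a: "a \<in> C" "dist (z n) a < e / 3"
        using C(2) by (subst (asm) cINF_less_iff) auto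
      then obtain x where "x \<in> k" "dist x a < e / 3"
        using k by auto
      moreover from this have "dist x y < 2 * e / 3"
        using a n dist_triangle_half_l[of x a "2 * (e / 3)" y] by (simp add: dist_commute)
      ultimately show ?thesis by auto
    qed
  qed
  also have "\<dots> \<subseteq> (\<Union>x\<in>k \<union> z ` {..<N}. cball x (2 * e / 3))"
    using ball_subset_cball by blast
  finally have "closure (range z) \<subseteq> (\<Union>x\<in>k \<union> z ` {..<N}. cball x (2 * e / 3))"
    by (rule closure_minimal) (use k in auto)
  also have "\<dots> \<subseteq> (\<Union>x\<in>k \<union> z ` {..<N}. ball x e)"
    using \<open>0 < e\<close> by (intro UN_mono) auto
  finally show "\<exists>k. finite k \<and> closure (range z) \<subseteq> (\<Union>x\<in>k. ball x e)"
    using k(1) by (intro exI[of _ "k \<union> z ` {..<N}"]) auto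
qed

lemma diagonal_convergent_subsequence:
  fixes z :: "nat \<Rightarrow> nat \<Rightarrow> 'a::metric_space"
  assumes "\<And>k. compact (closure (range (z k)))"
  obtains r where "strict_mono r" "\<And>k. convergent (\<lambda>i. z k (r i))"
proof -
  interpret subseqs "\<lambda>k s. convergent (\<lambda>i. z k (s i))"
  proof
    fix k and s :: "nat \<Rightarrow> nat"
    have "\<forall>i. z k (s i) \<in> closure (range (z k))"
      by (intro allI closure_subset[THEN subsetD] rangeI)
    then obtain l r where "strict_mono r" "((\<lambda>i. z k (s i)) \<circ> r) \<longlonglongrightarrow> l"
      by (rule seq_compactE[OF compact_imp_seq_compact[OF assms[of k]]])
    thus "\<exists>r. strict_mono r \<and> convergent (\<lambda>i. z k ((s \<circ> r) i))"
      by (auto simp: convergent_def o_def)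
  qed
  have "convergent (\<lambda>i. z k (diagseq i))" for k
  proof -
    \<comment> \<open>The diagonal sequence is a subsequence of the \<open>k\<close>-th refinement
      only from index \<open>Suc k\<close> on; a shift does not affect convergence.\<close>
    have "convergent (\<lambda>i. z k ((diagseq \<circ> (+) (Suc k)) i))"
    proof (rule diagseq_holds)
      fix r s :: "nat \<Rightarrow> nat" and n
      assume "strict_mono r" "convergent (\<lambda>i. z n (s i))"
      thus "convergent (\<lambda>i. z n ((s \<circ> r) i))"
        using convergent_subseq_convergent[of "\<lambda>i. z n (s i)" r] by (simp add: o_def)
    qed
    thus ?thesis
      using LIMSEQ_offset[of "\<lambda>i. z k (diagseq i)" "Suc k"] by (auto simp: convergent_def o_def add.commute)
  qed
  thus thesis
    using that subseq_diagseq by blast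
qed

text \<open>Arzela-Ascoli for paths with jumps. Equicontinuity holds only up to \<open>r n\<close>,
  but this error vanishes, so a diagonal subsequence at rational times converges at all times and
  its limit is 1-Lipschitz without error.\<close>

lemma asymptotically_lipschitz_subsequence:
  fixes w :: "nat \<Rightarrow> real \<Rightarrow> 'a::complete_space"
  assumes r: "r \<longlonglongrightarrow> 0"
    and lip: "\<And>n s t. \<lbrakk>0 \<le> s; s \<le> t\<rbrakk> \<Longrightarrow> dist (w n s) (w n t) \<le> t - s + r n"
    and near: "\<And>s e. \<lbrakk>0 \<le> s; 0 < e\<rbrakk> \<Longrightarrow>
      \<exists>C. compact C \<and> C \<noteq> {} \<and> (\<forall>\<^sub>F n in sequentially. infdist (w n s) C < e)"
  obtains \<phi> v where "strict_mono \<phi>" "\<And>s. 0 \<le> s \<Longrightarrow> (\<lambda>i. w (\<phi> i) s) \<longlonglongrightarrow> v s"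
    "1-lipschitz_on {0..} v"
proof -
  have lip': "dist (w n s) (w n t) \<le> \<bar>s - t\<bar> + r n" if "0 \<le> s" "0 \<le> t" for n s t
    using lip[of s t n] lip[of t s n] that by (cases "s \<le> t") (auto simp: dist_commute)
  define q where "q k = \<bar>real_of_rat (nat_to_rat_surj k)\<bar>" for k
  have dense: "\<exists>k. \<bar>q k - s\<bar> < e" if se: "0 \<le> s" "0 < e" for s e :: real
  proof -
    obtain a where "s < real_of_rat a" "real_of_rat a < s + e"
      using of_rat_dense[of s "s + e"] se by auto
    moreover obtain k where "a = nat_to_rat_surj k"
      using surj_nat_to_rat_surj by (metis surjD)
    ultimately show ?thesis
      using se unfolding q_def by (intro exI[of _ k]) (simp del: abs_of_rat)
  qed
  have "compact (closure (range (\<lambda>n. w n (q k))))" for k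
    by (rule compact_closure_range_if_near_compact, rule near) (auto simp: q_def)
  then obtain \<phi> where \<phi>: "strict_mono \<phi>" "\<And>k. convergent (\<lambda>i. w (\<phi> i) (q k))"
    using diagonal_convergent_subsequence[of "\<lambda>k n. w n (q k)"] by blast
  have r': "(\<lambda>i. r (\<phi> i)) \<longlonglongrightarrow> 0"
    using LIMSEQ_subseq_LIMSEQ[OF r \<phi>(1)] by (simp add: o_def)
  have "Cauchy (\<lambda>i. w (\<phi> i) s)" if s: "0 \<le> s" for s
  proof (rule metric_CauchyI)
    fix e :: real assume "0 < e"
    \<comment> \<open>Five parts: at each of the two indices, passing from \<open>s\<close> to
      \<open>q k\<close> costs one for the time and one for the jumps; the last is spent at
      \<open>q k\<close>.\<close>
    then obtain k where k: "\<bar>q k - s\<bar> < e / 5"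
      using dense[OF s, of "e / 5"] by auto
    have "Cauchy (\<lambda>i. w (\<phi> i) (q k))"
      by (rule convergent_Cauchy[OF \<phi>(2)])
    then obtain M1 where M1: "\<And>i j. \<lbrakk>M1 \<le> i; M1 \<le> j\<rbrakk> \<Longrightarrow> dist (w (\<phi> i) (q k)) (w (\<phi> j) (q k)) < e / 5"
      using \<open>0 < e\<close> by (metis metric_CauchyD zero_less_divide_iff zero_less_numeral)
    obtain M2 where M2: "\<And>i. M2 \<le> i \<Longrightarrow> r (\<phi> i) < e / 5"
      using order_tendstoD(2)[OF r', of "e / 5"] \<open>0 < e\<close> by (auto simp: eventually_sequentially)
    have close: "dist (w (\<phi> i) s) (w (\<phi> i) (q k)) < 2 * (e / 5)" if "M2 \<le> i" for i
      using lip'[of s "q k" "\<phi> i"] M2[OF that] k s by (auto simp: q_def abs_minus_commute)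
    show "\<exists>M. \<forall>i\<ge>M. \<forall>j\<ge>M. dist (w (\<phi> i) s) (w (\<phi> j) s) < e"
    proof (intro exI allI impI)
      fix i j assume "max M1 M2 \<le> i" "max M1 M2 \<le> j"
      hence "dist (w (\<phi> i) s) (w (\<phi> i) (q k)) < 2 * (e / 5)" "dist (w (\<phi> j) s) (w (\<phi> j) (q k)) < 2 * (e / 5)"
        "dist (w (\<phi> i) (q k)) (w (\<phi> j) (q k)) < e / 5"
        using close M1 by auto
      thus "dist (w (\<phi> i) s) (w (\<phi> j) s) < e"
        using dist_triangle[of "w (\<phi> i) s" "w (\<phi> j) s" "w (\<phi> i) (q k)"]
          dist_triangle2[of "w (\<phi> i) (q k)" "w (\<phi> j) s" "w (\<phi> j) (q k)"] by linarith
    qed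
  qed
  hence conv: "(\<lambda>i. w (\<phi> i) s) \<longlonglongrightarrow> lim (\<lambda>i. w (\<phi> i) s)" if "0 \<le> s" for s
    using that by (simp add: Cauchy_convergent convergent_LIMSEQ_iff[symmetric])
  show thesis
  proof (rule that[OF \<phi>(1) conv])
    show "1-lipschitz_on {0..} (\<lambda>s. lim (\<lambda>i. w (\<phi> i) s))"
    proof (rule lipschitz_onI)
      fix s t :: real assume st: "s \<in> {0..}" "t \<in> {0..}"
      have "(\<lambda>i. \<bar>s - t\<bar> + r (\<phi> i)) \<longlonglongrightarrow> \<bar>s - t\<bar> + 0"
        by (intro tendsto_intros r')
      moreover have "(\<lambda>i. dist (w (\<phi> i) s) (w (\<phi> i) t)) \<longlonglongrightarrow> dist (lim (\<lambda>i. w (\<phi> i) s)) (lim (\<lambda>i. w (\<phi> i) t))"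
        using st by (intro tendsto_dist conv) auto
      ultimately show "dist (lim (\<lambda>i. w (\<phi> i) s)) (lim (\<lambda>i. w (\<phi> i) t)) \<le> 1 * dist s t"
        using lip' st by (auto intro!: LIMSEQ_le simp: dist_real_def)
    qed simp
  qed
qed

text \<open>A path of small cost spends little time far from the compact sets \<open>C j\<close>, where the
  weight is large; this replaces local compactness of the space in the Arzela--Ascoli argument.\<close>

lemma exit_path_near_compact:
  fixes g :: "'a::{metric_space,second_countable_topology} \<Rightarrow> real"
  assumes path: "exit_path g U r x c w L" and c: "c < 1 / 2" and r: "r \<le> 1 / j" and j: "0 < j"
    and C: "x \<in> C" "\<And>y. d \<le> infdist y C \<Longrightarrow> j \<le> g y" and d: "0 \<le> d" "d \<le> 1 / j" and s: "0 \<le> s"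
  shows "infdist (w s) C \<le> 3 / j"
proof (rule ccontr)
  note w = exit_pathD[OF path]
  assume far: "\<not> infdist (w s) C \<le> 3 / j"
  \<comment> \<open>After \<open>L\<close> the path rests and its cost is no longer counted, so the
    time window below has to end by \<open>L\<close>.\<close>
  define \<tau> where "\<tau> = min s L"
  have ws: "w s = w \<tau>"
    using w(5)[of s] by (auto simp: \<tau>_def min_def)
  have \<tau>0: "0 \<le> \<tau>"
    using s w(1) by (simp add: \<tau>_def)
  have \<tau>j: "1 / j < \<tau>"
  proof (rule ccontr)
    assume "\<not> 1 / j < \<tau>"
    hence "infdist (w \<tau>) C \<le> 1 / j"
      using w(6)[OF \<tau>0] by (intro infdist_le2[OF C(1)]) (auto simp: dist_commute)
    also have "\<dots> \<le> 3 / j"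
      using j by (simp add: divide_right_mono)
    finally show False
      using far ws by simp
  qed
  \<comment> \<open>In the window of length \<open>1 / j\<close> before \<tau> the path is still far
    from \<open>C\<close>: the bound \<open>3 / j\<close> allows \<open>1 / j\<close> each for
    elapsed time, jumps and the margin \<open>d\<close>. With weight at least \<open>j\<close> the
    window alone costs 1, more than \<open>c\<close>.\<close>
  have ge: "j \<le> g (w u)" if u: "u \<in> {\<tau> - 1 / j..\<tau>}" for u
  proof (rule C(2), rule ccontr)
    assume "\<not> d \<le> infdist (w u) C"
    moreover have "dist (w \<tau>) (w u) \<le> 1 / j + r"
      using w(7)[of u \<tau>] u \<tau>j by (auto simp: dist_commute)
    moreover have "3 / j = 1 / j + 1 / j + 1 / j"
      by simp
    ultimately have "infdist (w \<tau>) C \<le> 3 / j"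
      using infdist_triangle[of "w \<tau>" C "w u"] r d by linarith
    thus False
      using far ws by simp
  qed
  have "1 = ennreal j * ennreal (1 / j)"
    using j by (simp flip: ennreal_mult)
  also have "\<dots> = (\<integral>\<^sup>+u. ennreal j * indicator {\<tau> - 1 / j..\<tau>} u \<partial>lborel)"
    using j by (simp add: nn_integral_cmult_indicator)
  also have "\<dots> \<le> (\<integral>\<^sup>+u\<in>{0..L}. ennreal (g (w u)) \<partial>lborel)"
    using ge \<tau>j by (intro nn_integral_mono) (auto simp: indicator_def \<tau>_def ennreal_leI)
  also have "\<dots> \<le> ennreal c"
    by (rule w(8))
  also have "\<dots> < 1"
    using c by (simp add: ennreal_less_one_iff)
  finally show False by simp
qed

text \<open>The floor \<eta> confines the exit times to a compact interval, the sets
  \<open>C j\<close> give compactness of the positions at each time, and the vanishing step sizes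
  make the limit a curve.\<close>

lemma exit_cost_limit_curve:
  fixes g :: "nat \<Rightarrow> 'a::polish_space \<Rightarrow> real"
  assumes g: "\<And>n. continuous_on UNIV (g n)" "\<And>n x. \<eta> \<le> g n x" "0 < \<eta>" "\<And>x. incseq (\<lambda>n. g n x)"
    and C: "\<And>j. compact (C j)" "\<And>j. K \<subseteq> C j"
      "\<And>j n y. \<lbrakk>j < n; 1 / n \<le> infdist y (C j)\<rbrakk> \<Longrightarrow> real j \<le> g n y"
    and U: "open U" and K: "compact K"
    and cheap: "\<And>n. \<exists>x\<in>K. \<exists>c<1/2. exit_cost (g n) U (1 / Suc n) x c"
  obtains v :: "real \<Rightarrow> 'a" and L where "0 \<le> L" "1-lipschitz_on {0..} v" "v 0 \<in> K" "v L \<notin> U"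
    "(\<integral>\<^sup>+s\<in>{0..L}. (SUP n. ennreal (g n (v s))) \<partial>lborel) \<le> ennreal (1 / 2)"
proof -
  have g0: "0 \<le> g n x" for n x
    using g(2)[where n = n and x = x] g(3) by linarith
  have [measurable]: "g n \<in> borel_measurable borel" for n
    using g(1) by (rule borel_measurable_continuous_onI)
  have "\<exists>x c w L. x \<in> K \<and> c < 1 / 2 \<and> exit_path (g n) U (1 / Suc n) x c w L" for n
  proof -
    obtain x c where "x \<in> K" "c < 1 / 2" "exit_cost (g n) U (1 / Suc n) x c"
      using cheap by blast
    moreover from exit_cost_path[OF this(3) g0 g(1)]
    obtain w L where "exit_path (g n) U (1 / Suc n) x c w L" by auto
    ultimately show ?thesis by blast
  qed
  then obtain x c w L where xK: "\<And>n. x n \<in> K" and c: "\<And>n. c n < (1 / 2 :: real)"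
    and path: "\<And>n. exit_path (g n) U (1 / Suc n) (x n) (c n) (w n) (L n)"
    by metis
  note w = exit_pathD[OF path]
  have [measurable]: "w n \<in> borel_measurable borel" for n
    by (rule w)
  have [measurable]: "(\<lambda>s. g k (w n s)) \<in> borel_measurable borel" for k n
    by (rule measurable_compose[of "w n" borel borel]) measurable
  have L_bound: "L n \<in> {0..1 / \<eta>}" for n
  proof -
    have "ennreal (\<eta> * L n) = (\<integral>\<^sup>+s. ennreal \<eta> * indicator {0..L n} s \<partial>lborel)"
      using w(1)[of n] g(3) by (simp add: nn_integral_cmult_indicator ennreal_mult)
    also have "\<dots> \<le> (\<integral>\<^sup>+s\<in>{0..L n}. ennreal (g n (w n s)) \<partial>lborel)"
      using g(2) by (intro nn_integral_mono) (auto simp: indicator_def ennreal_leI)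
    also have "\<dots> \<le> ennreal (c n)"
      by (rule w)
    also have "\<dots> \<le> ennreal 1"
      using c[of n] by (intro ennreal_leI) auto
    finally have "\<eta> * L n \<le> 1"
      by (subst (asm) ennreal_le_iff) auto
    thus ?thesis
      using g(3) w(1)[of n] by (simp add: field_simps)
  qed
  have "seq_compact {0..1 / \<eta>}"
    by (intro compact_imp_seq_compact) auto
  then obtain l \<psi> where \<psi>: "strict_mono \<psi>" "(L \<circ> \<psi>) \<longlonglongrightarrow> l" "l \<in> {0..1 / \<eta>}"
    using L_bound unfolding seq_compact_def by metis
  have near: "\<forall>\<^sub>F n in sequentially. infdist (w (\<psi> n) s) (C j) < e"
    if "0 \<le> s" "0 < e" "3 / e < real j" for s e j
  proof -
    have j: "0 < real j"
      using that by (smt (verit) divide_pos_pos)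
    have "infdist (w n s) (C j) < e" if n: "j < n" for n
    proof -
      have "infdist (w n s) (C j) \<le> 3 / j"
      proof (rule exit_path_near_compact[OF path c, where d = "1 / n"])
        show "1 / real (Suc n) \<le> 1 / real j" "1 / real n \<le> 1 / real j"
          using n j by (intro frac_le; simp)+
        show "x n \<in> C j"
          using xK C(2) by blast
      qed (use n j C(3) \<open>0 \<le> s\<close> in auto)
      also have "\<dots> < e"
        using \<open>3 / e < real j\<close> j \<open>0 < e\<close> by (simp add: field_simps)
      finally show ?thesis .
    qed
    moreover have "j < \<psi> n" if "Suc j \<le> n" for n
      using seq_suble[OF \<psi>(1), of n] that by simp
    ultimately show ?thesis
      by (intro eventually_sequentiallyI[of "Suc j"]) blast
  qed
  have r0: "(\<lambda>n. 1 / real (Suc (\<psi> n))) \<longlonglongrightarrow> 0"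
    using LIMSEQ_subseq_LIMSEQ[OF LIMSEQ_inverse_real_of_nat \<psi>(1)] by (simp add: o_def inverse_eq_divide)
  obtain \<phi> v where \<phi>: "strict_mono \<phi>" and v: "\<And>s. 0 \<le> s \<Longrightarrow> (\<lambda>i. w (\<psi> (\<phi> i)) s) \<longlonglongrightarrow> v s"
    and v_lip: "1-lipschitz_on {0..} v"
  proof (rule asymptotically_lipschitz_subsequence[of "\<lambda>n. 1 / real (Suc (\<psi> n))" "\<lambda>n. w (\<psi> n)"])
    show "(\<lambda>n. 1 / real (Suc (\<psi> n))) \<longlonglongrightarrow> 0" by (rule r0)
    show "dist (w (\<psi> n) s) (w (\<psi> n) t) \<le> t - s + 1 / real (Suc (\<psi> n))" if "0 \<le> s" "s \<le> t" for n s t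
      using w(7)[OF that] .
    show "\<exists>C. compact C \<and> C \<noteq> {} \<and> (\<forall>\<^sub>F n in sequentially. infdist (w (\<psi> n) s) C < e)"
      if "0 \<le> s" "0 < e" for s e
    proof -
      obtain j where "3 / e < real j"
        using reals_Archimedean2 by blast
      moreover have "C j \<noteq> {}"
        using C(2)[of j] xK by blast
      ultimately show ?thesis
        using near[OF that] C(1)[of j] by auto
    qed
  qed (rule that)
  define \<theta> where "\<theta> = \<psi> \<circ> \<phi>"
  have \<theta>: "strict_mono \<theta>"
    unfolding \<theta>_def by (rule strict_mono_o[OF \<psi>(1) \<phi>])
  have L_lim: "(\<lambda>i. L (\<theta> i)) \<longlonglongrightarrow> l"
    using LIMSEQ_subseq_LIMSEQ[OF \<psi>(2) \<phi>] by (simp add: o_def \<theta>_def)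
  have r_lim: "(\<lambda>i. 1 / real (Suc (\<theta> i))) \<longlonglongrightarrow> 0"
    using LIMSEQ_subseq_LIMSEQ[OF r0 \<phi>] by (simp add: o_def \<theta>_def)
  have v: "(\<lambda>i. w (\<theta> i) s) \<longlonglongrightarrow> v s" if "0 \<le> s" for s
    using v[OF that] by (simp add: \<theta>_def)
  have l0: "0 \<le> l"
    using \<psi>(3) by simp
  have "v 0 \<in> K"
    by (rule closed_sequentially[OF compact_imp_closed[OF K] _ v]) (simp_all add: w xK)
  \<comment> \<open>The paths converge only pointwise while the exit times vary; the almost
    Lipschitz bound moves \<open>L (\<theta> i)\<close> to \<open>l\<close> at a vanishing
    price.\<close>
  have "(\<lambda>i. dist (w (\<theta> i) (L (\<theta> i))) (v l)) \<longlonglongrightarrow> 0"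
  proof (rule Lim_null_comparison)
    have "(\<lambda>i. dist (w (\<theta> i) l) (v l)) \<longlonglongrightarrow> 0"
      using v[OF l0] by (simp add: tendsto_dist_iff[symmetric])
    hence "(\<lambda>i. (\<bar>L (\<theta> i) - l\<bar> + 1 / real (Suc (\<theta> i))) + dist (w (\<theta> i) l) (v l)) \<longlonglongrightarrow> (\<bar>l - l\<bar> + 0) + 0"
      by (intro tendsto_intros L_lim r_lim)
    thus "(\<lambda>i. (\<bar>L (\<theta> i) - l\<bar> + 1 / real (Suc (\<theta> i))) + dist (w (\<theta> i) l) (v l)) \<longlonglongrightarrow> 0"
      by simp
    show "\<forall>\<^sub>F i in sequentially. norm (dist (w (\<theta> i) (L (\<theta> i))) (v l)) \<le>
        (\<bar>L (\<theta> i) - l\<bar> + 1 / real (Suc (\<theta> i))) + dist (w (\<theta> i) l) (v l)"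
    proof (intro always_eventually allI)
      fix i
      have "dist (w (\<theta> i) (L (\<theta> i))) (w (\<theta> i) l) \<le> \<bar>L (\<theta> i) - l\<bar> + 1 / real (Suc (\<theta> i))"
        using w(7)[of "L (\<theta> i)" l "\<theta> i"] w(7)[of l "L (\<theta> i)" "\<theta> i"] l0 w(1)[of "\<theta> i"]
        by (cases "L (\<theta> i) \<le> l") (auto simp: dist_commute)
      thus "norm (dist (w (\<theta> i) (L (\<theta> i))) (v l)) \<le>
        (\<bar>L (\<theta> i) - l\<bar> + 1 / real (Suc (\<theta> i))) + dist (w (\<theta> i) l) (v l)"
        using dist_triangle[of "w (\<theta> i) (L (\<theta> i))" "v l" "w (\<theta> i) l"] by simp
    qed
  qed
  hence end_lim: "(\<lambda>i. w (\<theta> i) (L (\<theta> i))) \<longlonglongrightarrow> v l"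
    by (simp add: tendsto_dist_iff[symmetric])
  have "v l \<in> - U"
    by (rule closed_sequentially[OF _ _ end_lim]) (use U w(3) in auto)
  \<comment> \<open>Fatou's lemma for one fixed weight \<open>g k\<close>, which lies below
    \<open>g (\<theta> i)\<close> for large \<open>i\<close>. The endpoint \<open>l\<close> is left
    out because the exit times may stay below it; it is a null set and returns when the supremum
    over \<open>k\<close> is taken.\<close>
  have bound: "(\<integral>\<^sup>+s\<in>{0..<l}. ennreal (g k (v s)) \<partial>lborel) \<le> ennreal (1 / 2)" for k
  proof -
    have "(\<integral>\<^sup>+s\<in>{0..<l}. ennreal (g k (v s)) \<partial>lborel)
       \<le> (\<integral>\<^sup>+s. liminf (\<lambda>i. ennreal (g k (w (\<theta> i) s)) * indicator {0..L (\<theta> i)} s) \<partial>lborel)"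
    proof (intro nn_integral_mono)
      fix s
      show "ennreal (g k (v s)) * indicator {0..<l} s
          \<le> liminf (\<lambda>i. ennreal (g k (w (\<theta> i) s)) * indicator {0..L (\<theta> i)} s)"
      proof (cases "s \<in> {0..<l}")
        case True
        hence "\<forall>\<^sub>F i in sequentially. s < L (\<theta> i)"
          by (intro order_tendstoD(1)[OF L_lim]) auto
        hence ev: "\<forall>\<^sub>F i in sequentially. ennreal (g k (w (\<theta> i) s)) =
            ennreal (g k (w (\<theta> i) s)) * indicator {0..L (\<theta> i)} s"
          by eventually_elim (use True in auto)
        have "(\<lambda>i. g k (w (\<theta> i) s)) \<longlonglongrightarrow> g k (v s)"
          using g(1)[of k] v[of s] True by (intro continuous_on_tendsto_compose[of UNIV "g k"]) auto
        hence "(\<lambda>i. ennreal (g k (w (\<theta> i) s)) * indicator {0..L (\<theta> i)} s) \<longlonglongrightarrow> ennreal (g k (v s))"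
          by (rule Lim_transform_eventually[OF tendsto_ennrealI ev])
        from lim_imp_Liminf[OF sequentially_bot this] show ?thesis
          using True by simp
      qed simp
    qed
    also have "\<dots> \<le> liminf (\<lambda>i. \<integral>\<^sup>+s\<in>{0..L (\<theta> i)}. ennreal (g k (w (\<theta> i) s)) \<partial>lborel)"
      by (rule nn_integral_liminf) simp
    also have "\<dots> \<le> liminf (\<lambda>i. ennreal (1 / 2))"
    proof (rule Liminf_mono)
      show "\<forall>\<^sub>F i in sequentially. (\<integral>\<^sup>+s\<in>{0..L (\<theta> i)}. ennreal (g k (w (\<theta> i) s)) \<partial>lborel) \<le> ennreal (1 / 2)"
      proof (rule eventually_sequentiallyI)
        fix i assume "k \<le> i"
        hence "k \<le> \<theta> i"
          using seq_suble[OF \<theta>, of i] by simp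
        hence "g k y \<le> g (\<theta> i) y" for y
          using incseqD[OF g(4)] by blast
        hence "(\<integral>\<^sup>+s\<in>{0..L (\<theta> i)}. ennreal (g k (w (\<theta> i) s)) \<partial>lborel)
            \<le> (\<integral>\<^sup>+s\<in>{0..L (\<theta> i)}. ennreal (g (\<theta> i) (w (\<theta> i) s)) \<partial>lborel)"
          by (intro nn_integral_mono mult_right_mono ennreal_leI) auto
        also have "\<dots> \<le> ennreal (c (\<theta> i))"
          by (rule w)
        also have "\<dots> \<le> ennreal (1 / 2)"
          using c[of "\<theta> i"] by (intro ennreal_leI) auto
        finally show "(\<integral>\<^sup>+s\<in>{0..L (\<theta> i)}. ennreal (g k (w (\<theta> i) s)) \<partial>lborel) \<le> ennreal (1 / 2)" .
      qed
    qed
    finally show ?thesis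
      by (simp add: Liminf_const)
  qed
  have v_cont: "continuous_on {0..<l} (\<lambda>s. g k (v s))" for k
    by (rule continuous_on_compose2[OF g(1) continuous_on_subset[OF lipschitz_on_continuous_on[OF v_lip]]]) auto
  have v_meas: "(\<lambda>s. ennreal (g k (v s)) * indicator {0..<l} s) \<in> borel_measurable lborel" for k
    using borel_measurable_ennreal_continuous_on[OF _ v_cont[of k]] by simp
  have "(\<integral>\<^sup>+s\<in>{0..l}. (SUP k. ennreal (g k (v s))) \<partial>lborel)
      = (\<integral>\<^sup>+s. (SUP k. ennreal (g k (v s)) * indicator {0..<l} s) \<partial>lborel)"
    by (intro nn_integral_cong_AE, use AE_lborel_singleton[of l] in eventually_elim)
      (auto simp: indicator_def SUP_mult_right_ennreal)
  also have "\<dots> = (SUP k. \<integral>\<^sup>+s\<in>{0..<l}. ennreal (g k (v s)) \<partial>lborel)"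
    by (intro nn_integral_monotone_convergence_SUP v_meas incseq_SucI le_funI mult_right_mono
        ennreal_leI incseq_SucD[OF g(4)] zero_le)
  also have "\<dots> \<le> ennreal (1 / 2)"
    by (intro SUP_least bound)
  finally show thesis
    using that[OF l0 v_lip \<open>v 0 \<in> K\<close>] \<open>v l \<in> - U\<close> by auto
qed

section \<open>Continuous weights\<close>

text \<open>For open \<open>A\<close> these continuous functions increase to the indicator of
  \<open>A\<close>. The whole space is treated apart because \<open>infdist\<close> to the empty set
  is 0 by convention.\<close>

definition inner_ramp :: "nat \<Rightarrow> 'a::metric_space set \<Rightarrow> 'a \<Rightarrow> real" where
  "inner_ramp n A x = (if A = UNIV then 1 else min 1 (n * infdist x (- A)))"

lemma inner_ramp_nonneg: "0 \<le> inner_ramp n A x"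
  by (auto simp: inner_ramp_def infdist_nonneg)

lemma inner_ramp_le_indicator: "inner_ramp n A x \<le> indicator A x"
  by (auto simp: inner_ramp_def indicator_def)

lemma incseq_inner_ramp: "incseq (\<lambda>n. inner_ramp n A x)"
  unfolding inner_ramp_def
  by (cases "A = UNIV")
    (auto intro!: incseq_SucI min.mono mult_right_mono simp: infdist_nonneg simp del: of_nat_Suc min.bounded_iff)

lemma continuous_on_inner_ramp [continuous_intros]: "continuous_on S (inner_ramp n A)"
  unfolding inner_ramp_def by (cases "A = UNIV") (auto intro!: continuous_intros)

lemma inner_ramp_eq_1:
  assumes "1 / n \<le> infdist x (- A)" "0 < n"
  shows "inner_ramp n A x = 1"
  using assms by (auto simp: inner_ramp_def field_simps)

lemma eventually_inner_ramp_eq_1: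
  assumes "open A" "x \<in> A"
  shows "\<forall>\<^sub>F n in sequentially. inner_ramp n A x = 1"
proof (cases "A = UNIV")
  case False
  hence pos: "0 < infdist x (- A)"
    using assms by (intro infdist_pos_not_in_closed) auto
  then obtain N :: nat where N: "1 / infdist x (- A) < N"
    using reals_Archimedean2 by blast
  show ?thesis
  proof (rule eventually_sequentiallyI)
    fix n assume "N \<le> n"
    hence "1 / infdist x (- A) < real n"
      using N by linarith
    thus "inner_ramp n A x = 1"
      using pos by (auto simp: inner_ramp_def field_simps)
  qed
qed (simp add: inner_ramp_def)

section \<open>Dyadic layers and regularity of finite measures\<close>

lemma enn_powr_measurable [measurable]: "(\<lambda>x. enn_powr x p) \<in> borel_measurable borel"
  unfolding enn_powr_def by measurable

text \<open>The active layers form a geometric sum, at most twice its top term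
  \<open>e * 2 ^ Suc j\<close>, that is four times the level \<open>e * 2 ^ j\<close>, which lies
  below \<open>y\<close>.\<close>

lemma dyadic_layers_le:
  fixes y :: ennreal and e :: real
  assumes "0 < e"
  shows "(\<Sum>j<n. ennreal (e * 2 ^ Suc j) * indicator {z. ennreal (e * 2 ^ j) < z} y) \<le> 4 * y"
proof (induction n)
  case (Suc n)
  show ?case
  proof (cases "ennreal (e * 2 ^ n) < y")
    case True
    have *: "(\<Sum>j<m. e * 2 ^ Suc j) \<le> e * 2 ^ Suc m" for m
      using assms by (induction m) auto
    have "(\<Sum>j<Suc n. ennreal (e * 2 ^ Suc j) * indicator {z. ennreal (e * 2 ^ j) < z} y)
        \<le> (\<Sum>j<Suc n. ennreal (e * 2 ^ Suc j))"
      by (intro sum_mono) (auto simp: indicator_def)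
    also have "\<dots> = ennreal (\<Sum>j<Suc n. e * 2 ^ Suc j)"
      using assms by (intro sum_ennreal) auto
    also have "\<dots> \<le> ennreal (e * 2 ^ Suc (Suc n))"
      by (intro ennreal_leI *)
    also have "\<dots> = 4 * ennreal (e * 2 ^ n)"
      using assms by (simp add: ennreal_mult mult.left_commute flip: ennreal_numeral)
    also have "\<dots> \<le> 4 * y"
      using True by (intro mult_left_mono) auto
    finally show ?thesis .
  qed (use Suc in simp)
qed simp

lemma outer_regular_approx:
  fixes M :: "'a::polish_space measure"
  assumes M: "sets M = sets borel" "emeasure M (space M) \<noteq> \<infinity>" and "A \<in> sets borel" "0 < (e::real)"
  obtains U where "open U" "A \<subseteq> U" "measure M U \<le> measure M A + e"
proof -
  interpret finite_measure M by (rule finite_measureI[OF M(2)])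
  have "(INF U \<in> {U. A \<subseteq> U \<and> open U}. emeasure M U) < ennreal (measure M A + e)"
    unfolding outer_regular[OF M assms(3), symmetric]
    using \<open>0 < e\<close> by (simp add: emeasure_eq_measure ennreal_less_iff)
  then obtain U where "open U" "A \<subseteq> U" "emeasure M U < ennreal (measure M A + e)"
    by (auto simp: INF_less_iff)
  thus thesis
    using that[of U] by (simp add: emeasure_eq_measure ennreal_less_iff)
qed

lemma tight_approx:
  fixes M :: "'a::polish_space measure"
  assumes M: "sets M = sets borel" "emeasure M (space M) \<noteq> \<infinity>" and "0 < (e::real)"
  obtains C where "compact C" "measure M (- C) \<le> e"
proof -
  interpret finite_measure M by (rule finite_measureI[OF M(2)])
  have sp: "space M = UNIV"
    using sets_eq_imp_space_eq[OF M(1)] by simp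
  show thesis
  proof (cases "measure M UNIV \<le> e")
    case True
    thus thesis using that[of "{}"] by simp
  next
    case False
    have "ennreal (measure M UNIV - e) < (SUP K \<in> {K. K \<subseteq> UNIV \<and> compact K}. emeasure M K)"
      unfolding inner_regular[OF M sets.top[of borel, unfolded space_borel], symmetric]
      using \<open>0 < e\<close> False by (simp add: emeasure_eq_measure ennreal_less_iff)
    then obtain C where C: "compact C" "ennreal (measure M UNIV - e) < emeasure M C"
      by (auto simp: less_SUP_iff)
    hence "measure M UNIV - e < measure M C"
      using False by (simp add: emeasure_eq_measure ennreal_less_iff)
    moreover have "measure M (- C) = measure M UNIV - measure M C"
      using finite_measure_compl[of C] C(1) by (simp add: sp M(1) compact_imp_closed Compl_eq_Diff_UNIV)
    ultimately show thesis
      using that[OF C(1)] by simp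
  qed
qed

text \<open>A quantitative Vitali--Caratheodory approximation from above: the dyadic superlevel sets of
  \<open>R\<close> are enlarged to open sets. The extra summands \<open>a j\<close>, supported off compact sets of small
  complement, make sublevel sets of the limit weight precompact.\<close>

lemma continuous_weights_powr:
  fixes M :: "'a::polish_space measure" and R :: "'a \<Rightarrow> ennreal"
  assumes M: "sets M = sets borel" "emeasure M (space M) \<noteq> \<infinity>"
    and R: "R \<in> borel_measurable borel" "(\<integral>\<^sup>+x. R x \<partial>M) \<le> ennreal \<epsilon>"
    and \<epsilon>: "0 < \<epsilon>" and K: "compact K" and a: "\<And>j. 0 \<le> a j"
  obtains h :: "nat \<Rightarrow> 'a \<Rightarrow> real" and \<eta> :: real and C :: "nat \<Rightarrow> 'a set" where
    "\<And>n. continuous_on UNIV (h n)" "0 < \<eta>" "\<And>n x. \<eta> \<le> h n x" "\<And>n. \<exists>B. \<forall>x. h n x \<le> B"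
    "\<And>x. incseq (\<lambda>n. h n x)" "\<And>x. R x \<le> (SUP n. ennreal (h n x))"
    "\<And>n. (\<integral>\<^sup>+x. ennreal (h n x) \<partial>M) \<le> ennreal (7 * \<epsilon>)"
    "\<And>j. compact (C j)" "\<And>j. K \<subseteq> C j"
    "\<And>j n x. \<lbrakk>j < n; 1 / n \<le> infdist x (C j)\<rbrakk> \<Longrightarrow> a j \<le> h n x"
proof -
  interpret finite_measure M by (rule finite_measureI[OF M(2)])
  note [measurable_cong] = M(1)
  note [measurable] = R(1)
  \<comment> \<open>The floor of the weights: positive, so that it can serve as \<eta>, yet of
    integral at most \<epsilon>.\<close>
  define e where "e = \<epsilon> / (measure M UNIV + 1)"
  have e: "0 < e" "e * measure M UNIV \<le> \<epsilon>"
    using \<epsilon> measure_nonneg[of M UNIV] by (auto simp: e_def field_simps add_pos_nonneg)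
  define A where "A j = {x. ennreal (e * 2 ^ j) < R x}" for j
  have A_meas: "A j \<in> sets borel" for j
    unfolding A_def by measurable
  define \<delta> where "\<delta> j = \<epsilon> / 2 ^ Suc j" for j :: nat
  have \<delta>: "0 < \<delta> j" for j
    using \<epsilon> by (simp add: \<delta>_def)
  have \<delta>_sum: "(\<Sum>j<n. \<delta> j) \<le> \<epsilon>" for n
  proof -
    have "(\<Sum>j<n. \<delta> j) = \<epsilon> * (1 - 1 / 2 ^ n)"
      by (induction n) (auto simp: \<delta>_def field_simps)
    also have "\<dots> \<le> \<epsilon> * 1"
      using \<epsilon> by (intro mult_left_mono) auto
    finally show ?thesis by simp
  qed
  \<comment> \<open>The tolerance is divided by the height of the layer, so that enlarging layer
    \<open>j\<close> adds at most \<open>\<delta> j\<close> to the integral; likewise the tolerance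
    for \<open>C\<close> below is divided by \<open>a j + 1\<close>.\<close>
  have "\<exists>U. open U \<and> A j \<subseteq> U \<and> measure M U \<le> measure M (A j) + \<delta> j / (e * 2 ^ Suc j)" for j
    by (rule outer_regular_approx[OF M A_meas[of j], of "\<delta> j / (e * 2 ^ Suc j)"])
      (use \<delta>[of j] e in \<open>simp, blast\<close>)
  then obtain U where U: "\<And>j. open (U j)" "\<And>j. A j \<subseteq> U j"
    "\<And>j. measure M (U j) \<le> measure M (A j) + \<delta> j / (e * 2 ^ Suc j)"
    by metis
  have "\<exists>C. compact C \<and> measure M (- C) \<le> \<delta> j / (a j + 1)" for j
    by (rule tight_approx[OF M, of "\<delta> j / (a j + 1)"])
      (use \<delta>[of j] a[of j] in \<open>simp add: add_nonneg_pos, blast\<close>)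
  then obtain C where C: "\<And>j. compact (C j)" "\<And>j. measure M (- C j) \<le> \<delta> j / (a j + 1)"
    by metis
  define D where "D j = - (C j \<union> K)" for j
  have D: "open (D j)" for j
    using C(1) K by (auto simp: D_def intro!: open_Compl compact_imp_closed)
  have sets: "U j \<in> sets M" "D j \<in> sets M" "- C j \<in> sets M" "A j \<in> sets M" for j
    using U(1) D C(1) A_meas by (auto simp: M(1) compact_imp_closed intro!: borel_open)
  have D_small: "a j * measure M (D j) \<le> \<delta> j" for j
  proof -
    have "a j * measure M (D j) \<le> a j * (\<delta> j / (a j + 1))"
      using a sets by (intro mult_left_mono order_trans[OF finite_measure_mono C(2)]) (auto simp: D_def)
    also have "\<dots> \<le> \<delta> j"
      using a[of j] \<delta>[of j] by (simp add: field_simps)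
    finally show ?thesis .
  qed
  have U_small: "e * 2 ^ Suc j * measure M (U j) \<le> e * 2 ^ Suc j * measure M (A j) + \<delta> j" for j
  proof -
    have "e * 2 ^ Suc j * measure M (U j) \<le> e * 2 ^ Suc j * (measure M (A j) + \<delta> j / (e * 2 ^ Suc j))"
      using e by (intro mult_left_mono U) auto
    thus ?thesis
      using e by (simp add: distrib_left)
  qed
  have A_sum: "(\<Sum>j<n. e * 2 ^ Suc j * measure M (A j)) \<le> 4 * \<epsilon>" for n
  proof -
    have "ennreal (\<Sum>j<n. e * 2 ^ Suc j * measure M (A j))
        = (\<Sum>j<n. (\<integral>\<^sup>+x. ennreal (e * 2 ^ Suc j) * indicator (A j) x \<partial>M))"
      using e sets by (subst sum_ennreal[symmetric])
        (auto simp: nn_integral_cmult_indicator emeasure_eq_measure ennreal_mult)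
    also have "\<dots> = (\<integral>\<^sup>+x. (\<Sum>j<n. ennreal (e * 2 ^ Suc j) * indicator (A j) x) \<partial>M)"
      using sets by (intro nn_integral_sum[symmetric]) auto
    also have "\<dots> = (\<integral>\<^sup>+x. (\<Sum>j<n. ennreal (e * 2 ^ Suc j) * indicator {z. ennreal (e * 2 ^ j) < z} (R x)) \<partial>M)"
      by (intro nn_integral_cong sum.cong) (auto simp: A_def indicator_def)
    also have "\<dots> \<le> (\<integral>\<^sup>+x. 4 * R x \<partial>M)"
      by (intro nn_integral_mono dyadic_layers_le e)
    also have "\<dots> = 4 * (\<integral>\<^sup>+x. R x \<partial>M)"
      by (rule nn_integral_cmult) measurable
    also have "\<dots> \<le> 4 * ennreal \<epsilon>"
      by (intro mult_left_mono R) auto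
    also have "\<dots> = ennreal (4 * \<epsilon>)"
      using \<epsilon> by (simp add: ennreal_mult)
    finally show ?thesis
      using \<epsilon> by (subst (asm) ennreal_le_iff) auto
  qed
  \<comment> \<open>Stage \<open>n\<close> uses only the first \<open>n\<close> layers, with ramps
    of steepness \<open>n\<close>: each stage is bounded and continuous, and the stages
    increase.\<close>
  define t where "t n j x = a j * inner_ramp n (D j) x + e * 2 ^ Suc j * inner_ramp n (U j) x" for n j x
  define h where "h n x = e + (\<Sum>j<n. t n j x)" for n x
  have t0: "0 \<le> t n j x" for n j x
    using a e by (simp add: t_def inner_ramp_nonneg)
  have t_ind: "t n j x \<le> a j * indicator (D j) x + e * 2 ^ Suc j * indicator (U j) x" for n j x
    unfolding t_def using a e by (intro add_mono mult_left_mono inner_ramp_le_indicator) auto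
  have t_mono: "t n j x \<le> t (Suc n) j x" for n j x
    unfolding t_def using a e by (intro add_mono mult_left_mono incseq_SucD[OF incseq_inner_ramp]) auto
  have h_mono: "incseq (\<lambda>n. h n x)" for x
  proof (rule incseq_SucI)
    fix n
    have "(\<Sum>j<n. t n j x) \<le> (\<Sum>j<n. t (Suc n) j x)"
      by (intro sum_mono t_mono)
    thus "h n x \<le> h (Suc n) x"
      using t0[of "Suc n" n x] by (simp add: h_def)
  qed
  have t_le_h: "t n j x \<le> h n x" if "j < n" for n j x
    using member_le_sum[of j "{..<n}" "\<lambda>j. t n j x"] t0 that e by (simp add: h_def)
  show thesis
  proof (rule that[of h e "\<lambda>j. C j \<union> K"])
    show "continuous_on UNIV (h n)" for n
      unfolding h_def t_def by (intro continuous_intros)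
    show "e \<le> h n x" for n x
      using t0 by (simp add: h_def sum_nonneg)
    show "\<exists>B. \<forall>x. h n x \<le> B" for n
    proof (intro exI allI)
      fix x
      have "t n j x \<le> a j + e * 2 ^ Suc j" for j
        by (rule order_trans[OF t_ind]) (use a e in \<open>auto simp: indicator_def\<close>)
      thus "h n x \<le> e + (\<Sum>j<n. a j + e * 2 ^ Suc j)"
        by (simp only: h_def add_left_mono sum_mono)
    qed
    show "incseq (\<lambda>n. h n x)" for x
      by (rule h_mono)
    show "R x \<le> (SUP n. ennreal (h n x))" for x
    proof (rule ccontr)
      assume "\<not> R x \<le> (SUP n. ennreal (h n x))"
      hence less: "(SUP n. ennreal (h n x)) < R x" by simp
      \<comment> \<open>A ladder: a supremum of at least \<open>e * 2 ^ k\<close> but below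
        \<open>R x\<close> puts \<open>x\<close> in \<open>A k\<close>, hence in \<open>U k\<close>,
        and the ramp of that layer lifts the supremum to \<open>e * 2 ^ Suc k\<close>. So the
        supremum would be infinite.\<close>
      have "ennreal (e * 2 ^ k) \<le> (SUP n. ennreal (h n x))" for k
      proof (induction k)
        case 0
        show ?case
          by (rule SUP_upper2[of 0]) (auto simp: h_def)
      next
        case (Suc k)
        hence "x \<in> A k"
          using less by (simp add: A_def)
        hence "\<forall>\<^sub>F n in sequentially. inner_ramp n (U k) x = 1"
          using U by (intro eventually_inner_ramp_eq_1) auto
        then obtain N where N: "\<And>n. N \<le> n \<Longrightarrow> inner_ramp n (U k) x = 1"
          by (auto simp: eventually_sequentially)
        define n where "n = max N (Suc k)"
        have n: "inner_ramp n (U k) x = 1" "k < n"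
          using N by (auto simp: n_def)
        have "e * 2 ^ Suc k \<le> t n k x"
          using a n by (simp add: t_def inner_ramp_nonneg)
        also have "\<dots> \<le> h n x"
          by (rule t_le_h[OF n(2)])
        finally show ?case
          by (intro SUP_upper2[of n] ennreal_leI) auto
      qed
      hence le: "ennreal (e * 2 ^ k) \<le> (SUP n. ennreal (h n x))" for k .
      obtain s where s: "0 \<le> s" "(SUP n. ennreal (h n x)) = ennreal s"
        using less by (cases "SUP n. ennreal (h n x)") auto
      obtain k where "s / e < 2 ^ k"
        using real_arch_pow[of 2 "s / e"] by auto
      thus False
        using le[of k] e s by (simp add: field_simps)
    qed
    show "(\<integral>\<^sup>+x. ennreal (h n x) \<partial>M) \<le> ennreal (7 * \<epsilon>)" for n
    proof -
      have "(\<integral>\<^sup>+x. ennreal (h n x) \<partial>M) \<le>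
          (\<integral>\<^sup>+x. ennreal e + (\<Sum>j<n. ennreal (a j) * indicator (D j) x + ennreal (e * 2 ^ Suc j) * indicator (U j) x) \<partial>M)"
      proof (rule nn_integral_mono)
        fix x
        have "ennreal (h n x) = ennreal e + (\<Sum>j<n. ennreal (t n j x))"
          using e t0 by (simp add: h_def sum_nonneg)
        also have "\<dots> \<le> ennreal e + (\<Sum>j<n. ennreal (a j * indicator (D j) x + e * 2 ^ Suc j * indicator (U j) x))"
          by (intro add_left_mono sum_mono ennreal_leI t_ind)
        also have "\<dots> = ennreal e + (\<Sum>j<n. ennreal (a j) * indicator (D j) x + ennreal (e * 2 ^ Suc j) * indicator (U j) x)"
          using a e by (intro arg_cong2[where f = "(+)"] sum.cong) (auto simp: indicator_def)
        finally show "ennreal (h n x) \<le> \<dots>" .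
      qed
      also have "\<dots> = ennreal e * emeasure M (space M) +
          (\<Sum>j<n. ennreal (a j) * emeasure M (D j) + ennreal (e * 2 ^ Suc j) * emeasure M (U j))"
        using sets by (simp add: nn_integral_add nn_integral_sum nn_integral_cmult_indicator)
      also have "\<dots> = ennreal (e * measure M UNIV + (\<Sum>j<n. a j * measure M (D j) + e * 2 ^ Suc j * measure M (U j)))"
        using a e sets_eq_imp_space_eq[OF M(1)]
        by (simp add: emeasure_eq_measure ennreal_mult sum_nonneg flip: sum_ennreal)
      also have "\<dots> \<le> ennreal (7 * \<epsilon>)"
      proof (rule ennreal_leI)
        have "(\<Sum>j<n. a j * measure M (D j) + e * 2 ^ Suc j * measure M (U j))
            \<le> (\<Sum>j<n. \<delta> j + (e * 2 ^ Suc j * measure M (A j) + \<delta> j))"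
          by (intro sum_mono add_mono D_small U_small)
        also have "\<dots> = (\<Sum>j<n. \<delta> j) + ((\<Sum>j<n. e * 2 ^ Suc j * measure M (A j)) + (\<Sum>j<n. \<delta> j))"
          by (simp only: sum.distrib)
        \<comment> \<open>One \<epsilon> for the sets \<open>D j\<close>, four for the dyadic
          layers, one for their open enlargement; the floor adds the seventh.\<close>
        also have "\<dots> \<le> \<epsilon> + (4 * \<epsilon> + \<epsilon>)"
          by (intro add_mono A_sum \<delta>_sum)
        finally show "e * measure M UNIV + (\<Sum>j<n. a j * measure M (D j) + e * 2 ^ Suc j * measure M (U j)) \<le> 7 * \<epsilon>"
          using e by simp
      qed
      finally show ?thesis .
    qed
    show "a j \<le> h n x" if "j < n" "1 / n \<le> infdist x (C j \<union> K)" for j n x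
    proof -
      have "inner_ramp n (D j) x = 1"
        using that by (intro inner_ramp_eq_1) (auto simp: D_def)
      hence "a j \<le> t n j x"
        using e by (simp add: t_def inner_ramp_nonneg)
      thus ?thesis
        using t_le_h[OF that(1), of x] by simp
    qed
  qed (use e C K in auto)
qed

lemma le_enn_powr_imp:
  assumes "0 < p" "0 \<le> s" "enn_powr y p \<le> ennreal (s powr p)"
  shows "y \<le> ennreal s"
proof (cases y)
  case (real r)
  have "r \<le> s"
  proof (rule ccontr)
    assume "\<not> r \<le> s"
    hence "s powr p < r powr p"
      using assms by (intro powr_less_mono2) auto
    thus False
      using assms real by (simp add: enn_powr_def)
  qed
  thus ?thesis
    using real by (simp add: ennreal_leI)
qed (use assms in \<open>simp add: enn_powr_def top.extremum_unique\<close>)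

text \<open>The construction is applied to the \<open>p\<close>-th power of \<rho> and roots are
  taken afterwards; the levels \<open>real j powr p\<close> thereby become
  \<open>real j\<close>.\<close>

lemma continuous_weights:
  fixes M :: "'a::polish_space measure" and \<rho> :: "'a \<Rightarrow> ennreal"
  assumes M: "sets M = sets borel" "emeasure M (space M) \<noteq> \<infinity>"
    and \<rho>: "\<rho> \<in> borel_measurable borel" "(\<integral>\<^sup>+x. enn_powr (\<rho> x) p \<partial>M) \<le> ennreal \<epsilon>"
    and \<epsilon>: "0 < \<epsilon>" and K: "compact K" and p: "0 < p"
  obtains g :: "nat \<Rightarrow> 'a \<Rightarrow> real" and \<eta> :: real and C :: "nat \<Rightarrow> 'a set" where
    "\<And>n. continuous_on UNIV (g n)" "0 < \<eta>" "\<And>n x. \<eta> \<le> g n x" "\<And>n. \<exists>B. \<forall>x. g n x \<le> B"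
    "\<And>x. incseq (\<lambda>n. g n x)" "\<And>x. \<rho> x \<le> (SUP n. ennreal (g n x))"
    "\<And>n. (\<integral>\<^sup>+x. ennreal (g n x powr p) \<partial>M) \<le> ennreal (7 * \<epsilon>)"
    "\<And>j. compact (C j)" "\<And>j. K \<subseteq> C j"
    "\<And>j n x. \<lbrakk>j < n; 1 / n \<le> infdist x (C j)\<rbrakk> \<Longrightarrow> real j \<le> g n x"
proof -
  have meas: "(\<lambda>x. enn_powr (\<rho> x) p) \<in> borel_measurable borel"
    using measurable_compose[OF \<rho>(1) enn_powr_measurable] .
  obtain h \<eta> C where h: "\<And>n. continuous_on UNIV (h n)" "0 < \<eta>" "\<And>n x. \<eta> \<le> h n x"
    "\<And>n. \<exists>B. \<forall>x. h n x \<le> B" "\<And>x. incseq (\<lambda>n. h n x)"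
    "\<And>x. enn_powr (\<rho> x) p \<le> (SUP n. ennreal (h n x))"
    "\<And>n. (\<integral>\<^sup>+x. ennreal (h n x) \<partial>M) \<le> ennreal (7 * \<epsilon>)"
    and C: "\<And>j. compact (C j)" "\<And>j. K \<subseteq> C j"
    "\<And>j n x. \<lbrakk>j < n; 1 / n \<le> infdist x (C j)\<rbrakk> \<Longrightarrow> real j powr p \<le> h n x"
    by (rule continuous_weights_powr[OF M meas \<rho>(2) \<epsilon> K, of "\<lambda>j. real j powr p", OF powr_ge_zero]) (rule that)
  have pos: "0 < h n x" for n x
    using h(3)[of n x] h(2) by linarith
  define g where "g n x = h n x powr (1 / p)" for n x
  have gp: "g n x powr p = h n x" for n x
    using p pos[of n x] by (simp add: g_def powr_powr)
  have mono: "s powr (1 / p) \<le> t powr (1 / p)" if "0 \<le> s" "s \<le> t" for s t :: real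
    using p that by (intro powr_mono2) auto
  show thesis
  proof (rule that[of g "\<eta> powr (1 / p)" C])
    show "continuous_on UNIV (g n)" for n
      unfolding g_def by (intro continuous_intros h) (use pos[of n] in \<open>auto simp: less_imp_neq[symmetric]\<close>)
    show "0 < \<eta> powr (1 / p)"
      using h(2) by simp
    show "\<eta> powr (1 / p) \<le> g n x" for n x
      unfolding g_def by (rule mono) (use h in auto)
    show "\<exists>B. \<forall>x. g n x \<le> B" for n
    proof -
      obtain B where "\<And>x. h n x \<le> B"
        using h(4) by blast
      hence "\<forall>x. g n x \<le> B powr (1 / p)"
        unfolding g_def by (intro allI mono less_imp_le[OF pos])
      thus ?thesis by blast
    qed
    show "incseq (\<lambda>n. g n x)" for x
      unfolding g_def by (intro incseq_SucI mono less_imp_le[OF pos] incseq_SucD[OF h(5)])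
    show "\<rho> x \<le> (SUP n. ennreal (g n x))" for x
    proof (cases "SUP n. ennreal (g n x)")
      case (real s)
      have "enn_powr (\<rho> x) p \<le> ennreal (s powr p)"
      proof (rule order_trans[OF h(6)], rule SUP_least)
        fix n
        have "ennreal (g n x) \<le> ennreal s"
          unfolding real(2)[symmetric] by (rule SUP_upper) simp
        hence "g n x \<le> s"
          using real(1) by simp
        hence "g n x powr p \<le> s powr p"
          using p by (intro powr_mono2) (auto simp: g_def)
        thus "ennreal (h n x) \<le> ennreal (s powr p)"
          by (simp add: gp ennreal_leI)
      qed
      thus ?thesis
        unfolding real(2) by (rule le_enn_powr_imp[OF p real(1)])
    qed (simp only: top_greatest)
    show "(\<integral>\<^sup>+x. ennreal (g n x powr p) \<partial>M) \<le> ennreal (7 * \<epsilon>)" for n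
      unfolding gp by (rule h)
    show "real j \<le> g n x" if "j < n" "1 / n \<le> infdist x (C j)" for j n x
    proof -
      have "real j = (real j powr p) powr (1 / p)"
        using p by (simp add: powr_powr)
      also have "\<dots> \<le> g n x"
        unfolding g_def by (rule mono) (use C(3)[OF that] in auto)
      finally show ?thesis .
    qed
  qed (use C in auto)
qed

section \<open>Pairing with the bound of the derivation\<close>

text \<open>Young's inequality with the two cases \<open>g \<le> t * G powr (q - 1)\<close> and
  \<open>G \<le> (g / t) powr (p - 1)\<close> replaces Hoelder's inequality.\<close>

lemma young_split:
  fixes G g t p q :: real
  assumes "0 \<le> G" "0 \<le> g" "0 < t" "1 < q" "p = q / (q - 1)"
  shows "G * g \<le> t * G powr q + t powr (1 - p) * g powr p"
proof (cases "g \<le> t * G powr (q - 1)")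
  case True
  have "G * g \<le> G * (t * G powr (q - 1))"
    by (rule mult_left_mono[OF True assms(1)])
  also have "\<dots> = t * G powr q"
    using assms by (cases "G = 0") (auto simp: powr_diff)
  also have "\<dots> \<le> t * G powr q + t powr (1 - p) * g powr p"
    by simp
  finally show ?thesis .
next
  case False
  have "p - 1 = 1 / (q - 1)"
    unfolding assms(5) using assms(4) by (simp add: divide_simps)
  hence p: "0 < p - 1" "(q - 1) * (p - 1) = 1"
    using assms(4) by auto
  have g: "0 < g"
    using False assms by (smt (verit) mult_nonneg_nonneg powr_ge_zero)
  have "G = (G powr (q - 1)) powr (p - 1)"
    using assms p by (simp add: powr_powr)
  also have "\<dots> \<le> (g / t) powr (p - 1)"
    using False assms p by (intro powr_mono2) (auto simp: field_simps)
  also have "\<dots> = t powr (1 - p) * g powr (p - 1)"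
    using g assms by (simp add: powr_divide powr_diff field_simps)
  finally have "G * g \<le> t powr (1 - p) * g powr (p - 1) * g"
    using g by (intro mult_right_mono) auto
  also have "\<dots> = t powr (1 - p) * g powr p"
    using g by (simp add: powr_diff)
  also have "\<dots> \<le> t * G powr q + t powr (1 - p) * g powr p"
    using assms by simp
  finally show ?thesis .
qed

text \<open>The bound \<open>d\<close> depends on \<open>G\<close> and \<open>e\<close> alone, so it
  can be fixed before the weights are constructed.\<close>

lemma Lq_pairing_small:
  assumes G: "Lq m q G" "\<And>x. 0 \<le> G x" and pq: "conjugate_exps p q" and e: "0 < (e::real)"
  obtains d :: real where "0 < d"
    "\<And>g. \<lbrakk>g \<in> borel_measurable m; \<And>x. 0 \<le> g x; (\<integral>\<^sup>+x. ennreal (g x powr p) \<partial>m) \<le> ennreal d\<rbrakk>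
      \<Longrightarrow> (\<integral>\<^sup>+x. ennreal (G x * g x) \<partial>m) \<le> ennreal e"
proof (cases "q = \<infinity>")
  case True
  then obtain C where C: "AE x in m. \<bar>G x\<bar> \<le> C" and p: "p = 1"
    using G pq by (auto simp: Lq_def conjugate_exps_def)
  \<comment> \<open>Here \<open>p = 1\<close>. The added 1 keeps the denominator positive, whatever
    the essential bound \<open>C\<close>.\<close>
  define d where "d = e / (\<bar>C\<bar> + 1)"
  have d: "0 < d" "(\<bar>C\<bar> + 1) * d = e"
    using e by (auto simp: d_def)
  show thesis
  proof (rule that[OF d(1)])
    fix g :: "'a \<Rightarrow> real"
    assume g: "g \<in> borel_measurable m" "\<And>x. 0 \<le> g x" "(\<integral>\<^sup>+x. ennreal (g x powr p) \<partial>m) \<le> ennreal d"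
    have "(\<integral>\<^sup>+x. ennreal (G x * g x) \<partial>m) \<le> (\<integral>\<^sup>+x. ennreal (\<bar>C\<bar> + 1) * ennreal (g x powr p) \<partial>m)"
    proof (rule nn_integral_mono_AE, use C in eventually_elim)
      fix x assume "\<bar>G x\<bar> \<le> C"
      hence "G x * g x \<le> (\<bar>C\<bar> + 1) * (g x powr p)"
        using g(2)[of x] p by (auto intro: mult_right_mono)
      thus "ennreal (G x * g x) \<le> ennreal (\<bar>C\<bar> + 1) * ennreal (g x powr p)"
        by (subst ennreal_mult'[symmetric]) (auto intro: ennreal_leI)
    qed
    also have "\<dots> = ennreal (\<bar>C\<bar> + 1) * (\<integral>\<^sup>+x. ennreal (g x powr p) \<partial>m)"
      using g(1) by (intro nn_integral_cmult) simp
    also have "\<dots> \<le> ennreal (\<bar>C\<bar> + 1) * ennreal d"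
      by (intro mult_left_mono g) auto
    also have "\<dots> = ennreal e"
      using d by (simp add: ennreal_mult'[symmetric] del: ennreal_plus)
    finally show "(\<integral>\<^sup>+x. ennreal (G x * g x) \<partial>m) \<le> ennreal e" .
  qed
next
  case False
  define r where "r = real_of_ereal q"
  have "1 < q"
    using pq by (simp add: conjugate_exps_def)
  hence r: "1 < r" "p = r / (r - 1)"
    using pq False by (cases q; simp add: r_def conjugate_exps_def)+
  have int: "integrable m (\<lambda>x. G x powr r)" and [measurable]: "G \<in> borel_measurable m"
    using G False by (auto simp: Lq_def r_def)
  define I where "I = (\<integral>x. G x powr r \<partial>m)"
  have I: "(\<integral>\<^sup>+x. ennreal (G x powr r) \<partial>m) = ennreal I" "0 \<le> I"
    unfolding I_def by (auto intro: nn_integral_eq_integral int)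
  \<comment> \<open>Young's parameter makes the \<open>G\<close> part at most \<open>e / 2\<close>;
    \<open>d\<close> is then chosen so that the \<open>g\<close> part, carrying the large factor
    \<open>t powr (1 - p)\<close>, is at most \<open>e / 2\<close> too.\<close>
  define t where "t = e / (2 * (I + 1))"
  have t: "0 < t" "t * I \<le> e / 2"
    using e I by (auto simp: t_def field_simps add_nonneg_pos)
  define d where "d = e / 2 / t powr (1 - p)"
  have d: "0 < d" "t powr (1 - p) * d = e / 2"
    using e t by (auto simp: d_def)
  show thesis
  proof (rule that[OF d(1)])
    fix g :: "'a \<Rightarrow> real"
    assume g: "g \<in> borel_measurable m" "\<And>x. 0 \<le> g x" "(\<integral>\<^sup>+x. ennreal (g x powr p) \<partial>m) \<le> ennreal d"
    note [measurable] = g(1)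
    have "(\<integral>\<^sup>+x. ennreal (G x * g x) \<partial>m) \<le>
        (\<integral>\<^sup>+x. ennreal t * ennreal (G x powr r) + ennreal (t powr (1 - p)) * ennreal (g x powr p) \<partial>m)"
    proof (rule nn_integral_mono)
      fix x
      show "ennreal (G x * g x) \<le> ennreal t * ennreal (G x powr r) + ennreal (t powr (1 - p)) * ennreal (g x powr p)"
        using young_split[OF G(2) g(2) t(1) r] t
        by (simp add: ennreal_leI flip: ennreal_mult' ennreal_plus)
    qed
    also have "\<dots> = ennreal t * (\<integral>\<^sup>+x. ennreal (G x powr r) \<partial>m) +
        ennreal (t powr (1 - p)) * (\<integral>\<^sup>+x. ennreal (g x powr p) \<partial>m)"
      by (simp add: nn_integral_add nn_integral_cmult)
    also have "\<dots> \<le> ennreal t * ennreal I + ennreal (t powr (1 - p)) * ennreal d"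
      by (intro add_mono mult_left_mono g) (auto simp: I)
    also have "\<dots> = ennreal (t * I + e / 2)"
      unfolding d(2)[symmetric] using t I d by (simp flip: ennreal_mult' ennreal_plus)
    also have "\<dots> \<le> ennreal e"
      using t by (intro ennreal_leI) auto
    finally show "(\<integral>\<^sup>+x. ennreal (G x * g x) \<partial>m) \<le> ennreal e" .
  qed
qed

section \<open>Positivity of the modulus\<close>

text \<open>Inner regularity is applied to the finite restrictions of \<open>N\<close> to balls that
  exhaust the space.\<close>

lemma null_set_if_compact_subsets_null:
  fixes N :: "'a::polish_space measure"
  assumes N: "sets N = sets borel" "\<And>B. \<lbrakk>B \<in> sets borel; bounded B\<rbrakk> \<Longrightarrow> emeasure N B < \<infinity>"
    and A: "A \<in> sets borel" and null: "\<And>K. \<lbrakk>compact K; K \<subseteq> A\<rbrakk> \<Longrightarrow> emeasure N K = 0"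
  shows "emeasure N A = 0"
proof -
  fix x0 :: 'a
  have "emeasure N (A \<inter> ball x0 (real n)) = 0" for n
  proof -
    define M where "M = density N (indicator (ball x0 (real n)))"
    have M: "emeasure M B = emeasure N (B \<inter> ball x0 (real n))" if "B \<in> sets borel" for B
    proof -
      have "ball x0 (real n) \<in> sets N" "B \<in> sets N"
        using that N(1) by auto
      hence "emeasure M B = (\<integral>\<^sup>+x. indicator (ball x0 (real n)) x * indicator B x \<partial>N)"
        unfolding M_def by (intro emeasure_density borel_measurable_indicator)
      also have "\<dots> = (\<integral>\<^sup>+x. indicator (B \<inter> ball x0 (real n)) x \<partial>N)"
        by (intro nn_integral_cong) (auto simp: indicator_def)
      also have "\<dots> = emeasure N (B \<inter> ball x0 (real n))"
        using that N(1) by (intro nn_integral_indicator) auto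
      finally show ?thesis .
    qed
    have sM: "sets M = sets borel"
      by (simp add: M_def N(1))
    have "emeasure M (space M) \<noteq> \<infinity>"
      using N(2)[of "ball x0 (real n)"] sets_eq_imp_space_eq[OF sM] by (simp add: M)
    from inner_regular[OF sM this A] have "emeasure M A = (SUP K\<in>{K. K \<subseteq> A \<and> compact K}. emeasure M K)" .
    also have "\<dots> = 0"
    proof (rule antisym[OF SUP_least])
      fix K assume "K \<in> {K. K \<subseteq> A \<and> compact K}"
      hence K: "K \<subseteq> A" "compact K" "K \<in> sets borel"
        by (auto intro: borel_compact)
      have "emeasure M K \<le> emeasure N K"
        unfolding M[OF K(3)] by (rule emeasure_mono) (use K N in auto)
      thus "emeasure M K \<le> 0"
        using null[OF K(2,1)] by simp
    qed simp
    finally show ?thesis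
      by (simp add: M[OF A])
  qed
  hence "emeasure N (\<Union>n. A \<inter> ball x0 (real n)) = 0"
    by (intro emeasure_UN_eq_0) (auto simp: N(1) A)
  moreover have "(\<Union>n. A \<inter> ball x0 (real n)) = A"
    using reals_Archimedean2 by auto
  ultimately show ?thesis by simp
qed

text \<open>The open neighbourhoods of radius \<open>1 / Suc n\<close> decrease to \<open>K\<close>;
  being bounded they have finite measure, which permits continuity from above.\<close>

lemma compact_small_neighbourhood:
  fixes P :: "'a::metric_space measure"
  assumes P: "sets P = sets borel" "\<And>B. \<lbrakk>B \<in> sets borel; bounded B\<rbrakk> \<Longrightarrow> emeasure P B < \<infinity>"
    and K: "compact K" "K \<noteq> {}" "emeasure P K = 0" and e: "0 < (e::real)"
  obtains U where "open U" "bounded U" "K \<subseteq> U" "emeasure P U < ennreal e"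
proof -
  define V where "V n = {x. infdist x K < 1 / Suc n}" for n
  have V: "open (V n)" for n
    unfolding V_def by (intro open_Collect_less continuous_intros)
  have sub: "V (Suc n) \<subseteq> V n" for n
    unfolding V_def by (auto intro: less_le_trans simp: frac_le)
  obtain a r where ar: "K \<subseteq> cball a r"
    using compact_imp_bounded[OF K(1)] by (auto simp: bounded_subset_cball)
  have bdd: "bounded (V n)" for n
  proof (rule bounded_subset[OF bounded_cball[of a "r + 1"]], rule subsetI)
    fix x assume "x \<in> V n"
    hence "infdist x K < 1 / Suc n"
      by (simp add: V_def)
    also have "\<dots> \<le> 1"
      by simp
    finally have "(INF k\<in>K. dist x k) < 1"
      using K(2) by (simp add: infdist_notempty)
    then obtain k where "k \<in> K" "dist x k < 1"
      using K(2) by (subst (asm) cINF_less_iff) auto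
    thus "x \<in> cball a (r + 1)"
      using ar dist_triangle[of a x k] by (auto simp: dist_commute)
  qed
  have "(\<Inter>n. V n) = K"
  proof
    show "K \<subseteq> (\<Inter>n. V n)"
      by (auto simp: V_def)
    show "(\<Inter>n. V n) \<subseteq> K"
    proof
      fix x assume x: "x \<in> (\<Inter>n. V n)"
      have "infdist x K \<le> 0"
      proof (rule ccontr)
        assume "\<not> infdist x K \<le> 0"
        then obtain n where "1 / real (Suc n) < infdist x K"
          using reals_Archimedean[of "infdist x K"] by (auto simp: inverse_eq_divide)
        thus False
          using x by (auto simp: V_def dest: spec[of _ n])
      qed
      thus "x \<in> K"
        using K in_closed_iff_infdist_zero[OF compact_imp_closed[OF K(1)], of x] infdist_nonneg[of x K] by simp
    qed
  qed
  moreover have "(\<lambda>n. emeasure P (V n)) \<longlonglongrightarrow> emeasure P (\<Inter>n. V n)"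
    by (rule Lim_emeasure_decseq)
      (use V sub bdd P in \<open>auto intro!: decseq_SucI simp: less_top[symmetric]\<close>)
  ultimately have "(\<lambda>n. emeasure P (V n)) \<longlonglongrightarrow> 0"
    using K by simp
  hence "\<forall>\<^sub>F n in sequentially. emeasure P (V n) < ennreal e"
    by (rule order_tendstoD) (use e in simp)
  then obtain n where "emeasure P (V n) < ennreal e"
    by (auto simp: eventually_sequentially)
  moreover have "K \<subseteq> V n"
    by (auto simp: V_def)
  ultimately show thesis
    using that V bdd by blast
qed

text \<open>The hypothesis on \<Gamma> leaves the direction of travel open, so one argument serves
  both ends of the curves; every test is made with the potential of a neighbourhood of
  \<open>K\<close>.\<close>

lemma emeasure_compact_eq_0_if_no_curves:
  fixes m :: "'a::polish_space measure"
  assumes m: "mm_space m" and pq: "conjugate_exps p q"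
    and G: "Lq m q G" "\<And>x. 0 \<le> G x"
    and b: "\<And>f. f \<in> LIP_bs \<Longrightarrow> b f \<in> borel_measurable m"
      "\<And>f. f \<in> LIP_bs \<Longrightarrow> AE x in m. \<bar>b f x\<bar> \<le> G x * lip_a f x"
    and parts: "\<And>f. f \<in> LIP_bs \<Longrightarrow> (\<integral>x. b f x \<partial>m) = (\<integral>x. f x \<partial>N) - (\<integral>x. f x \<partial>P)"
    and P: "sets P = sets borel" "\<And>B. \<lbrakk>B \<in> sets borel; bounded B\<rbrakk> \<Longrightarrow> emeasure P B < \<infinity>"
    and N: "sets N = sets borel" "\<And>B. \<lbrakk>B \<in> sets borel; bounded B\<rbrakk> \<Longrightarrow> emeasure N B < \<infinity>"
    and K: "compact K" "emeasure P K = 0"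
    and mod: "curve_modulus m p \<Gamma> = 0"
    and curves: "\<And>(v :: real \<Rightarrow> 'a) L. \<lbrakk>0 \<le> L; 1-lipschitz_on {0..} v; v 0 \<in> K; v 0 \<noteq> v L\<rbrakk> \<Longrightarrow>
      \<exists>a c. (a = 0 \<and> c = L \<or> a = L \<and> c = - L) \<and> (\<lambda>t. v (a + c * t)) \<in> \<Gamma>"
  shows "emeasure N K = 0"
proof (cases "K = {}")
  case False
  have p: "0 < p"
    using pq by (cases q) (auto simp: conjugate_exps_def split: if_splits)
  have sm: "sets m = sets borel" and fin_m: "\<And>B. \<lbrakk>B \<in> sets borel; bounded B\<rbrakk> \<Longrightarrow> emeasure m B < \<infinity>"
    using m by (auto simp: mm_space_def)
  have K_borel: "K \<in> sets borel"
    using K(1) by (rule borel_compact)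
  \<comment> \<open>Since \<open>u \<ge> 1 / 2\<close> on \<open>K\<close>, half of
    \<open>measure N K\<close> is at most the integral of \<open>u\<close> against \<open>N\<close>,
    which equals that of \<open>b u\<close> against \<open>m\<close> plus that of \<open>u\<close>
    against \<open>P\<close>; each of these two is at most \<open>e\<close>.\<close>
  have "measure N K \<le> 4 * e" if e: "0 < e" for e :: real
  proof -
    obtain U where U: "open U" "bounded U" "K \<subseteq> U" "emeasure P U < ennreal e"
      using compact_small_neighbourhood[OF P K(1) False K(2) e] by blast
    define B where "B = closure U"
    have B: "B \<in> sets borel" "bounded B" "U \<subseteq> B"
      using U closure_subset by (auto simp: B_def)
    define M where "M = density m (indicator B)"
    have int_M: "(\<integral>\<^sup>+x. f x \<partial>M) = (\<integral>\<^sup>+x. f x * indicator B x \<partial>m)" if "f \<in> borel_measurable borel" for f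
      unfolding M_def using B that
      by (subst nn_integral_density) (auto simp: sm mult.commute cong: measurable_cong_sets)
    have sM: "sets M = sets borel"
      by (simp add: M_def sm)
    have "emeasure M (space M) = (\<integral>\<^sup>+x. 1 * indicator B x \<partial>m)"
      using int_M[of "\<lambda>_. 1"] by simp
    hence fin_M: "emeasure M (space M) \<noteq> \<infinity>"
      using fin_m[OF B(1,2)] B(1) by (simp add: sm less_top[symmetric])
    obtain d where d: "0 < d"
      "\<And>g. \<lbrakk>g \<in> borel_measurable m; \<And>x. 0 \<le> g x; (\<integral>\<^sup>+x. ennreal (g x powr p) \<partial>m) \<le> ennreal d\<rbrakk>
        \<Longrightarrow> (\<integral>\<^sup>+x. ennreal (G x * g x) \<partial>m) \<le> ennreal e"
      using Lq_pairing_small[OF G pq e] by blast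
    \<comment> \<open>The passage to continuous weights loses a factor 7.\<close>
    have "curve_modulus m p \<Gamma> < ennreal (d / 7)"
      using mod d(1) by simp
    then obtain \<rho> where \<rho>: "\<rho> \<in> borel_measurable borel" "\<And>\<gamma>. \<gamma> \<in> \<Gamma> \<Longrightarrow> 1 \<le> line_integral \<gamma> \<rho>"
      "(\<integral>\<^sup>+x. enn_powr (\<rho> x) p \<partial>m) < ennreal (d / 7)"
      by (auto simp: curve_modulus_def INF_less_iff)
    have "(\<integral>\<^sup>+x. enn_powr (\<rho> x) p \<partial>M) = (\<integral>\<^sup>+x. enn_powr (\<rho> x) p * indicator B x \<partial>m)"
      by (rule int_M[OF measurable_compose[OF \<rho>(1) enn_powr_measurable]])
    also have "\<dots> \<le> (\<integral>\<^sup>+x. enn_powr (\<rho> x) p \<partial>m)"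
      by (intro nn_integral_mono) (auto simp: indicator_def)
    finally have \<rho>_M: "(\<integral>\<^sup>+x. enn_powr (\<rho> x) p \<partial>M) \<le> ennreal (d / 7)"
      using \<rho>(3) by simp
    have "0 < d / 7"
      using d(1) by simp
    from continuous_weights[OF sM fin_M \<rho>(1) \<rho>_M this K(1) p]
    obtain g \<eta> C where g: "\<And>n. continuous_on UNIV (g n)" "0 < \<eta>" "\<And>n x. \<eta> \<le> g n x"
      "\<And>n. \<exists>B. \<forall>x. g n x \<le> B" "\<And>x. incseq (\<lambda>n. g n x)" "\<And>x. \<rho> x \<le> (SUP n. ennreal (g n x))"
      "\<And>n. (\<integral>\<^sup>+x. ennreal (g n x powr p) \<partial>M) \<le> ennreal (7 * (d / 7))"
      and C: "\<And>j. compact (C j)" "\<And>j. K \<subseteq> C j"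
      "\<And>j n x. \<lbrakk>j < n; 1 / n \<le> infdist x (C j)\<rbrakk> \<Longrightarrow> real j \<le> g n x"
      by blast
    have g0: "0 \<le> g n x" for n x
      using g(2) g(3)[of n x] by linarith
    have "\<exists>n. \<forall>x\<in>K. \<forall>c. exit_cost (g n) U (1 / Suc n) x c \<longrightarrow> 1 / 2 \<le> c"
    proof (rule ccontr)
      assume "\<not> ?thesis"
      hence cheap: "\<exists>x\<in>K. \<exists>c<1/2. exit_cost (g n) U (1 / Suc n) x c" for n
        by (meson not_le)
      obtain v :: "real \<Rightarrow> 'a" and L where v: "0 \<le> L" "1-lipschitz_on {0..} v" "v 0 \<in> K" "v L \<notin> U"
        "(\<integral>\<^sup>+s\<in>{0..L}. (SUP n. ennreal (g n (v s))) \<partial>lborel) \<le> ennreal (1 / 2)"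
      proof (rule exit_cost_limit_curve[OF g(1) g(3) g(2) g(5) C(1,2) _ U(1) K(1) cheap])
        show "real j \<le> g n y" if "j < n" "1 / real n \<le> infdist y (C j)" for j n y
          by (rule C(3)[OF that])
      qed (rule that)
      \<comment> \<open>The limit curve leads from inside \<open>U\<close> to its complement, so it
        is nonconstant and \<open>curves\<close> provides a member of \<Gamma>.\<close>
      have ne: "v 0 \<noteq> v L"
        using v U(3) by auto
      obtain a c where ac: "a = 0 \<and> c = L \<or> a = L \<and> c = - L" "(\<lambda>t. v (a + c * t)) \<in> \<Gamma>"
        using curves[OF v(1-3) ne] by blast
      have lip: "1-lipschitz_on {0..L} v"
        by (rule lipschitz_on_subset[OF v(2)]) auto
      have "1 \<le> line_integral (\<lambda>t. v (a + c * t)) \<rho>"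
        by (rule \<rho>(2)[OF ac(2)])
      also have "\<dots> \<le> (\<integral>\<^sup>+s\<in>{0..L}. (SUP n. ennreal (g n (v s))) \<partial>lborel)"
        by (rule line_integral_lipschitz_le[OF v(1) lip ne ac(1) g(1) g0 g(5,6)])
      also have "\<dots> \<le> ennreal (1 / 2)"
        by (rule v(5))
      finally have "ennreal 1 \<le> ennreal (1 / 2)"
        by simp
      thus False
        by (subst (asm) ennreal_le_iff) auto
    qed
    then obtain n where n: "\<And>x c. \<lbrakk>x \<in> K; exit_cost (g n) U (1 / Suc n) x c\<rbrakk> \<Longrightarrow> 1 / 2 \<le> c"
      by blast
    obtain H where H: "\<And>x. g n x \<le> H"
      using g(4) by blast
    define r where "r = 1 / real (Suc n)"
    have r: "0 < r"
      by (simp add: r_def)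
    define u where "u = exit_potential (g n) U r"
    note u_props = exit_potential_nonneg[of "g n" U r, OF g0] exit_potential_le_1[of "g n" U r, OF g0]
      exit_potential_outside[of "g n" _ U r, OF g0]
    have u: "\<And>x. 0 \<le> u x" "\<And>x. u x \<le> 1" "\<And>x. x \<notin> U \<Longrightarrow> u x = 0"
      using u_props by (simp_all add: u_def)
    have u_half: "1 / 2 \<le> u x" if "x \<in> K" for x
      unfolding u_def using n[OF that] by (intro exit_potential_ge[OF g0]) (auto simp: r_def)
    have u_LIP: "u \<in> LIP_bs"
      unfolding u_def by (rule exit_potential_LIP_bs[OF g0 r H U(2)])
    have u_meas: "u \<in> borel_measurable borel"
      unfolding u_def by (rule borel_measurable_continuous_onI
          [OF lipschitz_on_continuous_on[OF exit_potential_lipschitz[OF g0 r H]]])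
    have u_int: "integrable Q u"
      if "sets Q = sets borel" "\<And>B. \<lbrakk>B \<in> sets borel; bounded B\<rbrakk> \<Longrightarrow> emeasure Q B < \<infinity>" for Q
    proof (rule integrableI_bounded_set[where A = U and B = 1])
      show "u \<in> borel_measurable Q"
        using u_meas that(1) by (simp cong: measurable_cong_sets)
    qed (use u U that in auto)
    have "1 / 2 * measure N K \<le> (\<integral>x. u x \<partial>N)"
    proof -
      have "1 / 2 * measure N K = (\<integral>x. 1 / 2 * indicator K x \<partial>N)"
        using sets_eq_imp_space_eq[OF N(1)] by simp
      also have "\<dots> \<le> (\<integral>x. u x \<partial>N)"
      proof (rule integral_mono[OF _ u_int[OF N]])
        show "integrable N (\<lambda>x. 1 / 2 * indicator K x :: real)"
          using N(2)[OF K_borel compact_imp_bounded[OF K(1)]] N(1) K_borel by simp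
      qed (use u u_half in \<open>auto simp: indicator_def\<close>)
      finally show ?thesis .
    qed
    moreover have "(\<integral>x. u x \<partial>P) \<le> e"
    proof -
      have "(\<integral>x. u x \<partial>P) \<le> (\<integral>x. indicator U x \<partial>P)"
      proof (rule integral_mono[OF u_int[OF P]])
        show "integrable P (indicator U :: 'a \<Rightarrow> real)"
          using P(2)[of U] P(1) U by simp
      qed (use u in \<open>auto simp: indicator_def\<close>)
      also have "\<dots> = measure P U"
        using sets_eq_imp_space_eq[OF P(1)] by simp
      also have "\<dots> \<le> e"
        unfolding measure_def using U(4) e by (intro enn2real_leI) auto
      finally show ?thesis .
    qed
    moreover have "(\<integral>x. b u x \<partial>m) \<le> e"
    proof -
      \<comment> \<open>The weight is small in \<open>L^p\<close> only over \<open>B\<close>; the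
        cut-off is harmless because the slope of \<open>u\<close> vanishes off
        \<open>B\<close>.\<close>
      define g' where "g' x = g n x * indicator B x" for x
      have "g n \<in> borel_measurable borel"
        by (rule borel_measurable_continuous_onI[OF g(1)])
      hence g_meas: "g n \<in> borel_measurable m"
        using sm by (simp cong: measurable_cong_sets)
      have g': "g' \<in> borel_measurable m" "\<And>x. 0 \<le> g' x"
        unfolding g'_def using g_meas B(1) g0 sm by auto
      have "(\<integral>\<^sup>+x. ennreal (g' x powr p) \<partial>m) = (\<integral>\<^sup>+x. ennreal (g n x powr p) * indicator B x \<partial>m)"
        by (intro nn_integral_cong) (auto simp: g'_def indicator_def)
      also have "\<dots> = (\<integral>\<^sup>+x. ennreal (g n x powr p) \<partial>M)"
        using \<open>g n \<in> borel_measurable borel\<close> by (subst int_M) auto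
      also have "\<dots> \<le> ennreal d"
        using g(7)[of n] by simp
      finally have small: "(\<integral>\<^sup>+x. ennreal (G x * g' x) \<partial>m) \<le> ennreal e"
        by (rule d(2)[OF g'])
      have "(\<integral>\<^sup>+x. ennreal (norm (b u x)) \<partial>m) \<le> (\<integral>\<^sup>+x. ennreal (G x * g' x) \<partial>m)"
      proof (rule nn_integral_mono_AE, use b(2)[OF u_LIP] in eventually_elim)
        fix x assume "\<bar>b u x\<bar> \<le> G x * lip_a u x"
        also have "\<dots> \<le> G x * g' x"
          unfolding u_def g'_def B_def
          by (intro mult_left_mono lip_a_exit_potential_le[OF g0 H g(1) r] G)
        finally show "ennreal (norm (b u x)) \<le> ennreal (G x * g' x)"
          by (simp add: ennreal_leI)
      qed
      also note small
      finally have nn: "(\<integral>\<^sup>+x. ennreal (norm (b u x)) \<partial>m) \<le> ennreal e" .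
      have "integrable m (b u)"
        by (rule integrableI_bounded[OF b(1)[OF u_LIP]]) (use nn in \<open>simp add: order.strict_trans1\<close>)
      from integral_norm_bound_ennreal[OF this] nn
      have "ennreal (norm (\<integral>x. b u x \<partial>m)) \<le> ennreal e"
        by (rule order_trans)
      thus ?thesis
        using e by (subst (asm) ennreal_le_iff) auto
    qed
    ultimately show ?thesis
      using parts[OF u_LIP] by simp
  qed
  from this[of "e / 4" for e] have "measure N K \<le> 0 + e" if "0 < e" for e
    using that by simp
  hence "measure N K \<le> 0"
    by (rule field_le_epsilon)
  moreover have "emeasure N K \<noteq> \<infinity>"
    using N(2)[OF K_borel compact_imp_bounded[OF K(1)]] by simp
  ultimately show ?thesis
    by (simp add: emeasure_eq_ennreal_measure measure_le_0_iff)
qed simp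

lemma curve_modulus_mono: "\<Gamma> \<subseteq> \<Gamma>' \<Longrightarrow> curve_modulus m p \<Gamma> \<le> curve_modulus m p \<Gamma>'"
  unfolding curve_modulus_def by (intro INF_superset_mono) auto

lemma lipschitz_reparametrization_curve:
  fixes v :: "real \<Rightarrow> 'a::metric_space"
  assumes "0 \<le> L" "1-lipschitz_on {0..} v" "a = 0 \<and> c = L \<or> a = L \<and> c = - L" "v 0 \<noteq> v L"
  shows "(\<lambda>t. v (a + c * t)) \<in> curves" "0 < curve_length (\<lambda>t. v (a + c * t))"
proof -
  have dom: "a + c * t \<in> {0..}" if "t \<in> {0..1}" for t
    using assms(3)
  proof
    assume "a = L \<and> c = - L"
    moreover have "L * t \<le> L"
      using assms(1) that by (intro mult_left_le) auto
    ultimately show ?thesis by simp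
  qed (use assms(1) that in simp)
  have "continuous_on {0..1} (\<lambda>t. v (a + c * t))"
  proof (rule continuous_on_compose2[OF lipschitz_on_continuous_on[OF assms(2)]])
    show "continuous_on {0..1} (\<lambda>t. a + c * t)"
      by (intro continuous_intros)
  qed (use dom in blast)
  thus "(\<lambda>t. v (a + c * t)) \<in> curves"
    by (simp add: curves_def)
  have "0 < ennreal (dist (v (a + c * 0)) (v (a + c * 1)))"
    using assms(3,4) by auto
  thus "0 < curve_length (\<lambda>t. v (a + c * t))"
    using dist_le_curve_length[of "\<lambda>t. v (a + c * t)"] by (rule less_le_trans)
qed

text \<open>Mutual singularity reduces the claim to compact subsets of \<open>E - S\<close>: these
  are null for \<open>P\<close>, and \<open>N\<close> does not charge \<open>S\<close>.\<close>

lemma emeasure_eq_0_if_no_curves: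
  fixes m :: "'a::polish_space measure"
  assumes m: "mm_space m" and pq: "conjugate_exps p q"
    and G: "Lq m q G" "\<And>x. 0 \<le> G x"
    and b: "\<And>f. f \<in> LIP_bs \<Longrightarrow> b f \<in> borel_measurable m"
      "\<And>f. f \<in> LIP_bs \<Longrightarrow> AE x in m. \<bar>b f x\<bar> \<le> G x * lip_a f x"
    and parts: "\<And>f. f \<in> LIP_bs \<Longrightarrow> (\<integral>x. b f x \<partial>m) = (\<integral>x. f x \<partial>N) - (\<integral>x. f x \<partial>P)"
    and PN: "bf_jordan_pair P N" and E: "E \<in> sets borel"
    and mod: "curve_modulus m p {\<gamma>\<in>curves. \<gamma> t0 \<in> E \<and> curve_length \<gamma> > 0} = 0" and t0: "t0 = 0 \<or> t0 = 1"
  shows "emeasure N E = 0"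
proof -
  obtain S where S: "S \<in> sets borel" "emeasure P (UNIV - S) = 0" "emeasure N S = 0"
    using PN by (auto simp: bf_jordan_pair_def)
  have P: "sets P = sets borel" "\<And>B. \<lbrakk>B \<in> sets borel; bounded B\<rbrakk> \<Longrightarrow> emeasure P B < \<infinity>"
    and N: "sets N = sets borel" "\<And>B. \<lbrakk>B \<in> sets borel; bounded B\<rbrakk> \<Longrightarrow> emeasure N B < \<infinity>"
    using PN by (auto simp: bf_jordan_pair_def)
  have "emeasure N (E - S) = 0"
  proof (rule null_set_if_compact_subsets_null[OF N])
    fix K assume K: "compact K" "K \<subseteq> E - S"
    have "emeasure P K \<le> emeasure P (UNIV - S)"
      by (rule emeasure_mono) (use K S P in auto)
    hence PK: "emeasure P K = 0"
      using S by simp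
    show "emeasure N K = 0"
    proof (rule emeasure_compact_eq_0_if_no_curves[OF m pq G b parts P N K(1) _ mod])
      fix v :: "real \<Rightarrow> 'a" and L :: real
      assume v: "0 \<le> L" "1-lipschitz_on {0..} v" "v 0 \<in> K" "v 0 \<noteq> v L"
      \<comment> \<open>Chosen so that \<open>a + c * t0 = 0\<close>: the start \<open>v 0\<close>
        in \<open>K\<close> is visited at time \<open>t0\<close>, forwards for \<open>t0 = 0\<close>
        and backwards for \<open>t0 = 1\<close>.\<close>
      define a where "a = t0 * L"
      define c where "c = (1 - 2 * t0) * L"
      have ac: "a = 0 \<and> c = L \<or> a = L \<and> c = - L"
        using t0 by (auto simp: a_def c_def)
      have "v (a + c * t0) \<in> E"
        using t0 v(3) K(2) by (auto simp: a_def c_def)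
      thus "\<exists>a c. (a = 0 \<and> c = L \<or> a = L \<and> c = - L) \<and>
          (\<lambda>t. v (a + c * t)) \<in> {\<gamma> \<in> curves. \<gamma> t0 \<in> E \<and> curve_length \<gamma> > 0}"
        using lipschitz_reparametrization_curve[OF v(1,2) ac v(4)] ac by blast
    qed (use PK in auto)
  qed (use E S in auto)
  moreover have "emeasure N E \<le> emeasure N (E - S) + emeasure N S"
    using E S N by (intro order_trans[OF emeasure_mono emeasure_subadditive]) auto
  ultimately show ?thesis
    using S by simp
qed

theorem theorem5p11:
  fixes m :: "'a::polish_space measure"
    and p :: real and q :: ereal
    and b :: "('a \<Rightarrow> real) \<Rightarrow> 'a \<Rightarrow> real"
    and \<mu>P \<mu>N :: "'a measure"
    and E :: "'a set"
  assumes "mm_space m"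
    and "conjugate_exps p q"
    and "lip_derivation m q b"
    and "is_divergence m b \<mu>P \<mu>N"
    and "E \<in> sets borel"
  shows "(emeasure \<mu>N E > 0 \<longrightarrow>
            curve_modulus m p {\<gamma>\<in>curves. \<gamma> 0 \<in> E \<and> curve_length \<gamma> > 0} > 0)
       \<and> (emeasure \<mu>P E > 0 \<longrightarrow>
            curve_modulus m p {\<gamma>\<in>curves. \<gamma> 1 \<in> E \<and> curve_length \<gamma> > 0} > 0)
       \<and> (p_exceptional m p E \<longrightarrow> emeasure \<mu>P E + emeasure \<mu>N E = 0)"
proof -
  obtain G where G: "Lq m q G" "\<And>x. 0 \<le> G x"
    and b_le: "\<And>f. f \<in> LIP_bs \<Longrightarrow> AE x in m. \<bar>b f x\<bar> \<le> G x * lip_a f x"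
    using assms(3) by (auto simp: lip_derivation_def)
  have b_meas: "b f \<in> borel_measurable m" if "f \<in> LIP_bs" for f
    using assms(3) that by (auto simp: lip_derivation_def Lq_def)
  have jordan: "bf_jordan_pair \<mu>P \<mu>N"
    and parts: "\<And>f. f \<in> LIP_bs \<Longrightarrow> (\<integral>x. b f x \<partial>m) = - ((\<integral>x. f x \<partial>\<mu>P) - (\<integral>x. f x \<partial>\<mu>N))"
    using assms(4) by (auto simp: is_divergence_def)
  obtain S where S: "S \<in> sets borel" "emeasure \<mu>P (UNIV - S) = 0" "emeasure \<mu>N S = 0"
    using jordan by (auto simp: bf_jordan_pair_def)
  have jordan': "bf_jordan_pair \<mu>N \<mu>P"
    unfolding bf_jordan_pair_def
  proof (intro conjI bexI[of _ "UNIV - S"])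
    show "emeasure \<mu>N (UNIV - (UNIV - S)) = 0"
      using S(3) by (simp add: double_diff)
  qed (use jordan S in \<open>auto simp: bf_jordan_pair_def\<close>)
  have N0: "emeasure \<mu>N E = 0"
    if "curve_modulus m p {\<gamma>\<in>curves. \<gamma> 0 \<in> E \<and> curve_length \<gamma> > 0} = 0"
    by (rule emeasure_eq_0_if_no_curves[where b = b and P = \<mu>P, OF assms(1,2) G b_meas b_le _ jordan assms(5) that])
      (auto simp: parts)
  text \<open>The field \<open>-b\<close> exchanges the two parts of the divergence.\<close>
  have P0: "emeasure \<mu>P E = 0"
    if "curve_modulus m p {\<gamma>\<in>curves. \<gamma> 1 \<in> E \<and> curve_length \<gamma> > 0} = 0"
    by (rule emeasure_eq_0_if_no_curves[where b = "\<lambda>f x. - b f x" and P = \<mu>N,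
          OF assms(1,2) G _ _ _ jordan' assms(5) that])
      (auto simp: parts b_meas b_le)
  have sub: "curve_modulus m p {\<gamma>\<in>curves. \<gamma> t \<in> E \<and> curve_length \<gamma> > 0} = 0"
    if "p_exceptional m p E" "t \<in> {0..1}" for t :: real
  proof -
    have "curve_modulus m p {\<gamma>\<in>curves. \<gamma> t \<in> E \<and> curve_length \<gamma> > 0}
        \<le> curve_modulus m p {\<gamma>\<in>curves. curve_length \<gamma> > 0 \<and> (\<exists>t\<in>{0..1}. \<gamma> t \<in> E)}"
      by (rule curve_modulus_mono) (use that(2) in auto)
    thus ?thesis
      using that(1) by (simp add: p_exceptional_def)
  qed
  show ?thesis
    using N0 P0 sub[of 0] sub[of 1] by (auto simp: zero_less_iff_neq_zero)
qed

end
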